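(* Let $\mathbb{K}$ be a field, $\underline{Z}=(Z_1,\ldots,Z_s)$ indeterminates, $n\geq 2$, and let $f,g\in\mathbb{K}[Z_1,\ldots,Z_s][X_1,\ldots,X_n]$ be coprime, with $\deg_{\underline{Z}}(f)\leq k$, $\deg_{\underline{Z}}(g)\leq k$, $\deg_{\underline{X}}(f)\leq d$, $\deg_{\underline{X}}(g)\leq d$, and $\max(\deg_{\underline X} f,\deg_{\underline X} g)=d\geq 2$. For $\underline{z}=(z_1,\ldots,z_s)\in\mathbb{K}^s$ let $\mathrm{ev}_{\underline{z}}:\mathbb{K}[\underline{Z}]\to\mathbb{K}$ be the ring morphism sending $Z_i$ to $z_i$ (extended coefficientwise). Then there exists a finite collection $(q_i)_{i\in I}$ of nonzero polynomials in $\mathbb{K}[\underline{Z}]$ of degree smaller than $2(d^2-1)^2k$ such that, whenever the $\mathrm{ev}_{\underline{z}}(q_i)\in\mathbb{K}$ are not all zero, $$\mathrm{ev}_{\underline{z}}(\mathrm{Spect}_{f,g})=\kappa\cdot\mathrm{Spect}_{\mathrm{ev}_{\underline{z}}(f),\mathrm{ev}_{\underline{z}}(g)}$$ for some $0\neq\kappa\in\mathbb{K}$.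
   Context: Noether reducibility forms: for fixed $n\geq2$, $d\geq 2$, let $(\Phi_t)_{t\in T}$ be the Noether reducibility forms of Ruppert's effective Noether irreducibility theorem: a finite family of polynomials $\Phi_t\in\mathbb{Z}[C_e : e\in\mathbb{N}^n, |e|\leq d]$ (one variable per monomial $X^e$ of degree $\leq d$) with $\deg\Phi_t\leq d^2-1$, $\|\Phi_t\|_1\leq d^{3d^2-3}(\binom{n+d}{n}2^d)^{d^2-1}$, such that for every field $\mathbb{K}$ of characteristic $0$ or characteristic $p>d(d-1)$ (forms reduced mod $p$) and every $h=\sum_{|e|\leq d}c_eX^e\in\mathbb{K}[X_1,\ldots,X_n]$: all $\Phi_t(c)$ vanish iff $h$ is reducible over $\overline{\mathbb{K}}$ or $\deg h<d$. Spectral polynomial: for a UFD $A$ and $f,g\in A[X_1,\ldots,X_n]$ of degree $\leq d$, write $Vf-Ug=\sum_{|e|\leq d}c_e(U,V)X^e$ with $c_e\in A[U,V]$; $\mathrm{Spect}_{f,g}(U,V)$ is the GCD in $A[U,V]$ of the $\Phi_t(\ldots,c_e(U,V),\ldots)$, $t\in T$ (forms mapped to $A$ via $\mathbb{Z}\to A$). Here $A=\mathbb{K}[\underline Z]$ for $\mathrm{Spect}_{f,g}$ and $A=\mathbb{K}$ for the specialized one, with the same family $(\Phi_t)$. GCDs over a field are normalized monic with respect to a fixed monomial order.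
   Formalization: The degree bound is proved as "at most 2(d²−1)²k" instead of "smaller than": the strict bound is impossible for k=0 and fails in characteristic 2 for some families with the listed properties; the collection is required to be nonempty. *)

theory Defs
  imports
    "HOL-Library.Poly_Mapping"
    "HOL-Computational_Algebra.Polynomial"
    "HOL-Algebra.Algebraic_Closure"
begin

text \<open>
  Polynomials in indeterminates indexed by \<open>'v\<close>. A ring such as $A[X_1,\dots,X_n]$ is the set of
  polynomials over \<open>A\<close> in the indeterminates \<open>0, \<dots>, n - 1\<close>, see \<open>in_vars\<close>; since \<open>A\<close> is always a
  domain here, divisors of a nonzero polynomial involve no further indeterminates.
\<close>

type_synonym 'v monom = "'v \<Rightarrow>\<^sub>0 nat"
type_synonym ('v, 'a) mpoly = "'v monom \<Rightarrow>\<^sub>0 'a"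

definition mon_deg :: "'v monom \<Rightarrow> nat" where
  "mon_deg m = (\<Sum>v\<in>Poly_Mapping.keys m. Poly_Mapping.lookup m v)"

text \<open>Total degree; the zero polynomial has degree 0.\<close>

definition mdeg :: "('v, 'a::zero) mpoly \<Rightarrow> nat" where
  "mdeg p = Max (insert 0 (mon_deg ` Poly_Mapping.keys p))"

definition in_vars :: "'v set \<Rightarrow> ('v, 'a::zero) mpoly \<Rightarrow> bool" where
  "in_vars V p \<longleftrightarrow> (\<forall>m\<in>Poly_Mapping.keys p. Poly_Mapping.keys m \<subseteq> V)"

definition mon_eval :: "('v \<Rightarrow> 'a::comm_semiring_1) \<Rightarrow> 'v monom \<Rightarrow> 'a" where
  "mon_eval x m = (\<Prod>v\<in>Poly_Mapping.keys m. x v ^ Poly_Mapping.lookup m v)"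

definition ev :: "('v \<Rightarrow> 'a::comm_semiring_1) \<Rightarrow> ('v, 'a) mpoly \<Rightarrow> 'a" where
  "ev x p = (\<Sum>m\<in>Poly_Mapping.keys p. Poly_Mapping.lookup p m * mon_eval x m)"

definition ev_int :: "('v \<Rightarrow> 'a::comm_ring_1) \<Rightarrow> ('v, int) mpoly \<Rightarrow> 'a" where
  "ev_int x P = (\<Sum>m\<in>Poly_Mapping.keys P. of_int (Poly_Mapping.lookup P m) * mon_eval x m)"

text \<open>The order on monomials is the lexicographic one of \<open>HOL-Library.Poly_Mapping\<close>.\<close>

definition mlead_coeff :: "(nat, 'a::zero) mpoly \<Rightarrow> 'a" where
  "mlead_coeff p = Poly_Mapping.lookup p (Max (Poly_Mapping.keys p))"

text \<open>
  The library's \<open>coprime\<close> requires a division operation, which \<open>mpoly\<close> does not carry.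
\<close>

definition coprime_elems :: "'a::comm_semiring_1 \<Rightarrow> 'a \<Rightarrow> bool" where
  "coprime_elems a b \<longleftrightarrow> (\<forall>c. c dvd a \<longrightarrow> c dvd b \<longrightarrow> c dvd 1)"

definition is_gcd :: "'a::comm_semiring_1 set \<Rightarrow> 'a \<Rightarrow> bool" where
  "is_gcd S D \<longleftrightarrow> (\<forall>p\<in>S. D dvd p) \<and> (\<forall>E. (\<forall>p\<in>S. E dvd p) \<longrightarrow> E dvd D)"


subsection \<open>Noether reducibility forms\<close>

text \<open>
  The defining property of the forms ranges over all fields, so fields are taken here as
  HOL-Algebra structures, and polynomials over such a field are coefficient functions.
\<close>

definition ring_char :: "('u, 'm) ring_scheme \<Rightarrow> nat" where
  "ring_char F =
     (if \<exists>m::nat. 0 < m \<and> add_pow F m \<one>\<^bsub>F\<^esub> = \<zero>\<^bsub>F\<^esub>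
      then LEAST m::nat. 0 < m \<and> add_pow F m \<one>\<^bsub>F\<^esub> = \<zero>\<^bsub>F\<^esub> else 0)"

definition cf_support :: "('u, 'm) ring_scheme \<Rightarrow> (nat monom \<Rightarrow> 'u) \<Rightarrow> nat monom set" where
  "cf_support F h = {e. h e \<noteq> \<zero>\<^bsub>F\<^esub>}"

definition cf_polys :: "('u, 'm) ring_scheme \<Rightarrow> nat \<Rightarrow> (nat monom \<Rightarrow> 'u) set" where
  "cf_polys F n = {h. range h \<subseteq> carrier F \<and> finite (cf_support F h) \<and>
                      (\<forall>e\<in>cf_support F h. Poly_Mapping.keys e \<subseteq> {..<n})}"

definition cf_deg :: "('u, 'm) ring_scheme \<Rightarrow> (nat monom \<Rightarrow> 'u) \<Rightarrow> nat" where
  "cf_deg F h = Max (insert 0 (mon_deg ` cf_support F h))"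

definition cf_mult ::
  "('u, 'm) ring_scheme \<Rightarrow> (nat monom \<Rightarrow> 'u) \<Rightarrow> (nat monom \<Rightarrow> 'u) \<Rightarrow> nat monom \<Rightarrow> 'u" where
  "cf_mult F a b e = (\<Oplus>\<^bsub>F\<^esub>x\<in>{(u, v). u + v = e}. a (fst x) \<otimes>\<^bsub>F\<^esub> b (snd x))"

definition cf_reducible :: "('u, 'm) ring_scheme \<Rightarrow> nat \<Rightarrow> (nat monom \<Rightarrow> 'u) \<Rightarrow> bool" where
  "cf_reducible F n h \<longleftrightarrow>
     (\<exists>a\<in>cf_polys F n. \<exists>b\<in>cf_polys F n. 0 < cf_deg F a \<and> 0 < cf_deg F b \<and> h = cf_mult F a b)"

definition cf_ev_int :: "('u, 'm) ring_scheme \<Rightarrow> ('v \<Rightarrow> 'u) \<Rightarrow> ('v, int) mpoly \<Rightarrow> 'u" where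
  "cf_ev_int F c P =
     (\<Oplus>\<^bsub>F\<^esub>m\<in>Poly_Mapping.keys P. add_pow F (Poly_Mapping.lookup P m)
        (\<Otimes>\<^bsub>F\<^esub>v\<in>Poly_Mapping.keys m. c v [^]\<^bsub>F\<^esub> Poly_Mapping.lookup m v))"

text \<open>
  \<open>field.alg_closure F\<close> is the library's algebraic closure; \<open>ring.indexed_const F\<close> is the embedding
  of \<open>F\<close> into it.
\<close>

definition noether_criterion ::
  "('u, 'm) ring_scheme \<Rightarrow> nat \<Rightarrow> nat \<Rightarrow> 't set \<Rightarrow> ('t \<Rightarrow> (nat monom, int) mpoly) \<Rightarrow> bool" where
  "noether_criterion F n d T \<Phi> \<longleftrightarrow>
     (\<forall>h\<in>cf_polys F n. cf_deg F h \<le> d \<longrightarrow>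
        ((\<forall>t\<in>T. cf_ev_int F h (\<Phi> t) = \<zero>\<^bsub>F\<^esub>) \<longleftrightarrow>
         cf_reducible (field.alg_closure F) n (ring.indexed_const F \<circ> h) \<or> cf_deg F h < d))"

text \<open>
  The type \<open>'u\<close> is the universe that the fields are drawn from. Any infinite \<open>'u\<close> gives the criterion
  for all fields whatsoever, because an instance of it only involves a finitely generated field.
\<close>

definition noether_forms ::
  "'u itself \<Rightarrow> nat \<Rightarrow> nat \<Rightarrow> 't set \<Rightarrow> ('t \<Rightarrow> (nat monom, int) mpoly) \<Rightarrow> bool" where
  "noether_forms (_ :: 'u itself) n d T \<Phi> \<longleftrightarrow>
     finite T \<and>
     (\<forall>t\<in>T. in_vars {e. Poly_Mapping.keys e \<subseteq> {..<n} \<and> mon_deg e \<le> d} (\<Phi> t) \<and>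
            mdeg (\<Phi> t) \<le> d\<^sup>2 - 1 \<and>
            (\<Sum>m\<in>Poly_Mapping.keys (\<Phi> t). \<bar>Poly_Mapping.lookup (\<Phi> t) m\<bar>)
              \<le> int (d ^ (3 * d\<^sup>2 - 3) * (((n + d) choose n) * 2 ^ d) ^ (d\<^sup>2 - 1))) \<and>
     (\<forall>F :: 'u ring. field F \<and> (ring_char F = 0 \<or> d * (d - 1) < ring_char F) \<longrightarrow>
        noether_criterion F n d T \<Phi>)"


subsection \<open>The spectral polynomial\<close>

text \<open>$A[U,V]$ is represented as $A[U][V]$.\<close>

definition var_U :: "'a::comm_ring_1 poly poly" where
  "var_U = [:[:0, 1:]:]"

definition var_V :: "'a::comm_ring_1 poly poly" where
  "var_V = [:0, 1:]"

definition pencil_coeff ::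
  "(nat, 'a::comm_ring_1) mpoly \<Rightarrow> (nat, 'a) mpoly \<Rightarrow> nat monom \<Rightarrow> 'a poly poly" where
  "pencil_coeff f g e =
     var_V * [:[:Poly_Mapping.lookup f e:]:] - var_U * [:[:Poly_Mapping.lookup g e:]:]"

text \<open>
  The GCD is normalized to be monic for a lexicographic order with $V > U$. The parameter
  \<open>lc :: 'a \<Rightarrow> 'k\<close> continues the leading coefficient from \<open>A\<close> down to the ground field: the identity
  if \<open>A\<close> is the field itself, \<open>mlead_coeff\<close> if \<open>A\<close> is a polynomial ring over it.
\<close>

definition spect ::
  "('a \<Rightarrow> 'k::field) \<Rightarrow> 't set \<Rightarrow> ('t \<Rightarrow> (nat monom, int) mpoly) \<Rightarrow>
   (nat, 'a::comm_ring_1) mpoly \<Rightarrow> (nat, 'a) mpoly \<Rightarrow> 'a poly poly" where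
  "spect lc T \<Phi> f g =
     (THE D. is_gcd ((\<lambda>t. ev_int (pencil_coeff f g) (\<Phi> t)) ` T) D \<and>
             (D = 0 \<or> lc (Polynomial.lead_coeff (Polynomial.lead_coeff D)) = 1))"

abbreviation spect_field ::
  "'t set \<Rightarrow> ('t \<Rightarrow> (nat monom, int) mpoly) \<Rightarrow>
   (nat, 'k::field) mpoly \<Rightarrow> (nat, 'k) mpoly \<Rightarrow> 'k poly poly" where
  "spect_field \<equiv> spect (\<lambda>a. a)"

abbreviation spect_mpoly ::
  "'t set \<Rightarrow> ('t \<Rightarrow> (nat monom, int) mpoly) \<Rightarrow>
   (nat, (nat, 'k::field) mpoly) mpoly \<Rightarrow> (nat, (nat, 'k) mpoly) mpoly \<Rightarrow>
   (nat, 'k) mpoly poly poly" where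
  "spect_mpoly \<equiv> spect mlead_coeff"

end

theory Submission
  imports Defs "Jordan_Normal_Form.Char_Poly"
begin

text \<open>
  Write \<open>A = K[Z]\<close>, \<open>D = d\<^sup>2 - 1\<close> and let \<open>b\<^sub>t = S w\<^sub>t\<close> be the values of the forms on the pencil, where \<open>S\<close> is
  their GCD and the cofactors \<open>w\<^sub>t\<close> are coprime in \<open>A[U,V]\<close>. The specialized GCD is
  the specialization of \<open>S\<close> as soon as the specialized cofactors are coprime. These have degree at
  most \<open>D\<close> in \<open>U, V\<close> and at most \<open>D k\<close> in \<open>Z\<close>. If \<open>K\<close> has more than \<open>D\<close> elements, then after a shear
  \<open>U \<mapsto> U + a V\<close> one cofactor has its full total degree \<open>e\<close> as degree in \<open>V\<close>, with leading coefficient in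
  \<open>A\<close>, and some \<open>K\<close>-linear combination of the cofactors shares no factor of positive \<open>V\<close>-degree with it. The
  Sylvester determinant of size \<open>2 e \<le> 2 D\<close> of these two polynomials is nonzero, and any of its
  nonzero coefficients is a suitable \<open>q\<close>: the coefficients of \<open>V\<^sup>e\<close> being constant in \<open>U\<close>, the
  determinant also vanishes if there is a common factor depending on \<open>U\<close> only. If \<open>K\<close> has at most \<open>D\<close>
  elements, the product of all \<open>Z\<^sub>0 - a\<close> vanishes everywhere on \<open>K\<close> and makes the claim vacuous, unless
  all coefficients are constants, in which case there is nothing to specialize.
\<close>

hide_const (open) Polynomials.degree Polynomials.lead_coeff up_ring.coeff up_ring.monom
  module.smult Divisibility.irreducible
hide_fact (open) Divisibility.irreducible_def

section \<open>Degree functions\<close>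

text \<open>The family of cofactors is coprime only as a whole; two of its members may well share a
  factor, so their Sylvester determinant may vanish. This forces the linear combination. The
  threshold D comes from counting: a shear is bad only at one of the at most e roots of the top
  homogeneous part, and each of the at most e irreducible factors of positive V-degree spoils at
  most one scalar whenever a further cofactor joins the combination. The bound is 2 D times D k: at
  most 2 D entries in each product of the determinant, each of Z-degree at most D k, since a form of
  degree D is evaluated at coefficients of Z-degree k and a divisor never has larger degree. Several
  degrees are estimated in the same way (in Z, in U and V, in the indeterminates that must not
  occur), so the estimates are made for an abstract \<open>\<delta>\<close> that is additive on
  products. A \<open>\<delta>\<close> vanishing exactly on a smaller polynomial ring turns the
  absence of further indeterminates into one more degree bound.\<close>

definition degfun :: "('a::idom \<Rightarrow> nat) \<Rightarrow> bool" where
  "degfun \<delta> \<longleftrightarrow> \<delta> 0 = 0 \<and> (\<forall>a. \<delta> (- a) = \<delta> a) \<and> (\<forall>a b. \<delta> (a + b) \<le> max (\<delta> a) (\<delta> b)) \<and>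
     (\<forall>a b. a \<noteq> 0 \<longrightarrow> b \<noteq> 0 \<longrightarrow> \<delta> (a * b) = \<delta> a + \<delta> b)"

context
  fixes \<delta> :: "'a::idom \<Rightarrow> nat"
  assumes \<delta>: "degfun \<delta>"
begin

lemma degfun_0: "\<delta> 0 = 0"
  and degfun_uminus: "\<delta> (- a) = \<delta> a"
  and degfun_add_le_max: "\<delta> (a + b) \<le> max (\<delta> a) (\<delta> b)"
  and degfun_mult: "a \<noteq> 0 \<Longrightarrow> b \<noteq> 0 \<Longrightarrow> \<delta> (a * b) = \<delta> a + \<delta> b"
  using \<delta> unfolding degfun_def by auto

lemma degfun_mult_le: "\<delta> (a * b) \<le> \<delta> a + \<delta> b"
  using degfun_mult[of a b] degfun_0 by (cases "a = 0 \<or> b = 0") auto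

lemma degfun_diff_le_max: "\<delta> (a - b) \<le> max (\<delta> a) (\<delta> b)"
  using degfun_add_le_max[of a "- b"] degfun_uminus by simp

lemma degfun_1: "\<delta> 1 = 0"
  using degfun_mult[of 1 1] by simp

lemma degfun_power_le: "\<delta> (a ^ n) \<le> n * \<delta> a"
proof (induction n)
  case (Suc n)
  then show ?case using degfun_mult_le[of a "a ^ n"] by simp
qed (simp add: degfun_1)

lemma degfun_sum_le: "(\<And>i. i \<in> I \<Longrightarrow> \<delta> (x i) \<le> n) \<Longrightarrow> \<delta> (sum x I) \<le> n"
proof (induction I rule: infinite_finite_induct)
  case (insert i I)
  then show ?case using degfun_add_le_max[of "x i" "sum x I"] by fastforce
qed (auto simp: degfun_0)

lemma degfun_prod_le: "\<delta> (prod x I) \<le> (\<Sum>i\<in>I. \<delta> (x i))"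
proof (induction I rule: infinite_finite_induct)
  case (insert i I)
  then show ?case using degfun_mult_le[of "x i" "prod x I"] by fastforce
qed (auto simp: degfun_1)

lemma degfun_of_nat: "\<delta> (of_nat n) = 0"
proof (induction n)
  case (Suc n)
  then show ?case using degfun_add_le_max[of 1 "of_nat n"] by (simp add: degfun_1)
qed (simp add: degfun_0)

lemma degfun_of_int: "\<delta> (of_int n) = 0"
  by (cases n rule: int_cases2) (simp_all add: degfun_of_nat degfun_uminus)

text \<open>\<open>b = 0\<close> is a separate case because \<open>\<delta> 0 = 0\<close> is not
  smaller than \<open>\<delta> a\<close> when \<open>\<delta> a = 0\<close>.\<close>

lemma degfun_add_lower:
  assumes "a \<noteq> 0" "b = 0 \<or> \<delta> b < \<delta> a"
  shows "a + b \<noteq> 0 \<and> \<delta> (a + b) = \<delta> a"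
proof (cases "b = 0")
  case False
  then have "\<delta> b < \<delta> a" using assms by simp
  moreover have "\<delta> a \<le> max (\<delta> (a + b)) (\<delta> b)"
    using degfun_add_le_max[of "a + b" "- b"] degfun_uminus by simp
  ultimately show ?thesis
    using degfun_add_le_max[of a b] degfun_0
    by (metis le_antisym linorder_not_le max.absorb1 max_less_iff_conj nat_less_le zero_le)
qed (use assms in simp)

lemma degfun_sum_lower:
  assumes "\<And>i. i \<in> I \<Longrightarrow> x i = 0 \<or> \<delta> (x i) < n"
  shows "sum x I = 0 \<or> \<delta> (sum x I) < n"
proof (cases n)
  case 0
  then show ?thesis using assms by simp
next
  case (Suc m)
  then show ?thesis using degfun_sum_le[of I x m] assms degfun_0
    by (metis less_Suc_eq_le zero_le)
qed

lemma degfun_dvd_le: "a dvd b \<Longrightarrow> b \<noteq> 0 \<Longrightarrow> \<delta> a \<le> \<delta> b"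
  by (auto elim!: dvdE simp: degfun_mult)

end

lemma degfun_const_0: "degfun (\<lambda>_. 0)"
  by (simp add: degfun_def)

lemma degfun_degree: "degfun Polynomial.degree"
  by (simp add: degfun_def degree_add_le_max degree_mult_eq)

lemma degfun_comp:
  assumes "degfun \<delta>" "inj_comm_ring_hom h"
  shows "degfun (\<lambda>x. \<delta> (h x))"
proof -
  interpret inj_comm_ring_hom h by fact
  show ?thesis using assms(1) unfolding degfun_def by (simp add: hom_distribs)
qed

text \<open>The weight \<open>w\<close> of the new variable covers both uses: \<open>w = 1\<close>
  over \<open>degree\<close> gives the total degree in U and V, while \<open>w = 0\<close> ignores
  the variable and takes the maximum of \<open>\<delta>\<close> over the coefficients.\<close>

definition poly_degfun :: "nat \<Rightarrow> ('a::zero \<Rightarrow> nat) \<Rightarrow> 'a poly \<Rightarrow> nat" where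
  "poly_degfun w \<delta> p = Max (insert 0 ((\<lambda>i. w * i + \<delta> (coeff p i)) ` {i. coeff p i \<noteq> 0}))"

lemma finite_coeff_support: "finite {i. coeff p i \<noteq> 0}"
  by (rule finite_subset[of _ "{..degree p}"]) (auto intro: le_degree)

lemma poly_degfun_le_iff:
  "poly_degfun w \<delta> p \<le> n \<longleftrightarrow> (\<forall>i. coeff p i \<noteq> 0 \<longrightarrow> w * i + \<delta> (coeff p i) \<le> n)"
  unfolding poly_degfun_def by (subst Max_le_iff) (auto simp: finite_coeff_support)

lemma poly_degfun_ge: "coeff p i \<noteq> 0 \<Longrightarrow> w * i + \<delta> (coeff p i) \<le> poly_degfun w \<delta> p"
  using poly_degfun_le_iff by blast

text \<open>The index is the last one that attains the maximum; this isolates a single dominating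
  summand in a product.\<close>

lemma poly_degfun_attained:
  assumes "p \<noteq> 0"
  obtains i where "coeff p i \<noteq> 0" "poly_degfun w \<delta> p = w * i + \<delta> (coeff p i)"
    "\<And>j. coeff p j \<noteq> 0 \<Longrightarrow> i < j \<Longrightarrow> w * j + \<delta> (coeff p j) < poly_degfun w \<delta> p"
proof -
  let ?v = "\<lambda>i. w * i + \<delta> (coeff p i)" and ?N = "{i. coeff p i \<noteq> 0}"
  have ne: "?N \<noteq> {}" using assms leading_coeff_0_iff by blast
  have M: "poly_degfun w \<delta> p = Max (?v ` ?N)"
    unfolding poly_degfun_def using ne finite_coeff_support by (subst Max_insert) auto
  define I where "I = {i. coeff p i \<noteq> 0 \<and> ?v i = poly_degfun w \<delta> p}"
  have fin: "finite I" unfolding I_def by (rule finite_subset[OF _ finite_coeff_support[of p]]) auto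
  have "Max (?v ` ?N) \<in> ?v ` ?N" using ne finite_coeff_support by (intro Max_in) auto
  then have "I \<noteq> {}" unfolding I_def M by (force simp: image_iff)
  then have mem: "Max I \<in> I" using fin by (rule Max_in[rotated])
  show thesis
  proof (rule that[of "Max I"])
    fix j assume j: "coeff p j \<noteq> 0" "Max I < j"
    then have "j \<notin> I" using fin Max_ge leD by blast
    then show "?v j < poly_degfun w \<delta> p"
      using poly_degfun_ge[OF j(1), of w \<delta>] j(1) unfolding I_def by auto
  qed (use mem I_def in auto)
qed

text \<open>For products, take in each factor the last coefficient that attains its degree. In the
  coefficient of the product at the sum of the two indices this pair strictly dominates all other
  summands, so it cannot cancel.\<close>

lemma degfun_poly_degfun:
  assumes \<delta>: "degfun \<delta>"
  shows "degfun (poly_degfun w \<delta>)"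
  unfolding degfun_def
proof (intro conjI allI impI)
  show "poly_degfun w \<delta> 0 = 0" by (simp add: poly_degfun_def)
  show "poly_degfun w \<delta> (- p) = poly_degfun w \<delta> p" for p
    by (simp add: poly_degfun_def degfun_uminus[OF \<delta>])
  show "poly_degfun w \<delta> (p + q) \<le> max (poly_degfun w \<delta> p) (poly_degfun w \<delta> q)" for p q
    unfolding poly_degfun_le_iff
  proof (intro allI impI)
    fix i assume "coeff (p + q) i \<noteq> 0"
    let ?m = "max (poly_degfun w \<delta> p) (poly_degfun w \<delta> q)"
    show "w * i + \<delta> (coeff (p + q) i) \<le> ?m"
    proof (cases "coeff p i = 0 \<or> coeff q i = 0")
      case True
      with \<open>coeff (p + q) i \<noteq> 0\<close> show ?thesis
        using poly_degfun_ge[of p i w \<delta>] poly_degfun_ge[of q i w \<delta>] by (auto simp: le_max_iff_disj)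
    next
      case False
      then have "w * i + \<delta> (coeff p i) \<le> ?m" "w * i + \<delta> (coeff q i) \<le> ?m"
        using poly_degfun_ge[of p i w \<delta>] poly_degfun_ge[of q i w \<delta>] by (auto simp: le_max_iff_disj)
      then show ?thesis using degfun_add_le_max[OF \<delta>, of "coeff p i" "coeff q i"] by fastforce
    qed
  qed
  show "poly_degfun w \<delta> (p * q) = poly_degfun w \<delta> p + poly_degfun w \<delta> q" if "p \<noteq> 0" "q \<noteq> 0" for p q
  proof (rule antisym)
    have summand: "p' * q' = 0 \<or> w * k + \<delta> (p' * q') \<le> m + n"
      if "p' \<noteq> 0 \<Longrightarrow> w * i + \<delta> p' \<le> m" "q' \<noteq> 0 \<Longrightarrow> w * (k - i) + \<delta> q' \<le> n" "i \<le> k" for p' q' i k m n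
    proof (cases "p' * q' = 0")
      case False
      have "w * k = w * i + w * (k - i)" using \<open>i \<le> k\<close> by (simp add: distrib_left[symmetric])
      then show ?thesis using False that degfun_mult[OF \<delta>, of p' q'] by auto
    qed simp
    show "poly_degfun w \<delta> (p * q) \<le> poly_degfun w \<delta> p + poly_degfun w \<delta> q"
      unfolding poly_degfun_le_iff
    proof (intro allI impI)
      fix k assume nz: "coeff (p * q) k \<noteq> 0"
      let ?m = "poly_degfun w \<delta> p + poly_degfun w \<delta> q"
      have *: "coeff p i * coeff q (k - i) = 0 \<or> w * k + \<delta> (coeff p i * coeff q (k - i)) \<le> ?m"
        if "i \<le> k" for i
        using summand[of "coeff p i" i "poly_degfun w \<delta> p" "coeff q (k - i)" k "poly_degfun w \<delta> q"]
          poly_degfun_ge that by blast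
      \<comment> \<open>A nonzero summand gives \<open>w * k \<le> ?m\<close>, so the subtraction of
        naturals below is not truncated.\<close>
      have "\<exists>i\<le>k. coeff p i * coeff q (k - i) \<noteq> 0"
        using nz unfolding coeff_mult by (meson atMost_iff sum.neutral)
      then have "w * k \<le> ?m" using * by fastforce
      moreover have "\<delta> (coeff (p * q) k) \<le> ?m - w * k"
        unfolding coeff_mult by (rule degfun_sum_le[OF \<delta>]) (use * degfun_0[OF \<delta>] in fastforce)
      ultimately show "w * k + \<delta> (coeff (p * q) k) \<le> ?m" by linarith
    qed
    obtain i where i: "coeff p i \<noteq> 0" "poly_degfun w \<delta> p = w * i + \<delta> (coeff p i)"
      "\<And>j. coeff p j \<noteq> 0 \<Longrightarrow> i < j \<Longrightarrow> w * j + \<delta> (coeff p j) < poly_degfun w \<delta> p"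
      using poly_degfun_attained[OF \<open>p \<noteq> 0\<close>, of w \<delta>] by blast
    obtain j where j: "coeff q j \<noteq> 0" "poly_degfun w \<delta> q = w * j + \<delta> (coeff q j)"
      "\<And>l. coeff q l \<noteq> 0 \<Longrightarrow> j < l \<Longrightarrow> w * l + \<delta> (coeff q l) < poly_degfun w \<delta> q"
      using poly_degfun_attained[OF \<open>q \<noteq> 0\<close>, of w \<delta>] by blast
    let ?k = "i + j" and ?a = "coeff p i * coeff q j"
    let ?r = "\<Sum>l\<in>{..?k} - {i}. coeff p l * coeff q (?k - l)"
    have split: "coeff (p * q) ?k = ?a + ?r"
      unfolding coeff_mult by (subst sum.remove[of _ i]) auto
    have a: "?a \<noteq> 0" "\<delta> ?a = \<delta> (coeff p i) + \<delta> (coeff q j)"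
      using i(1) j(1) degfun_mult[OF \<delta>] by auto
    have "?r = 0 \<or> \<delta> ?r < \<delta> ?a"
    proof (rule degfun_sum_lower[OF \<delta>])
      fix l assume l: "l \<in> {..?k} - {i}"
      show "coeff p l * coeff q (?k - l) = 0 \<or> \<delta> (coeff p l * coeff q (?k - l)) < \<delta> ?a"
      proof (cases "coeff p l = 0 \<or> coeff q (?k - l) = 0")
        case False
        have wk: "w * i + w * j = w * l + w * (?k - l)"
          using l by (simp add: distrib_left[symmetric])
        have "w * l + \<delta> (coeff p l) \<le> poly_degfun w \<delta> p"
          "w * (?k - l) + \<delta> (coeff q (?k - l)) \<le> poly_degfun w \<delta> q"
          using False poly_degfun_ge by blast+
        \<comment> \<open>Any other splitting of \<open>?k\<close> overshoots \<open>i\<close> or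
          \<open>j\<close>, beyond which the maximum is not attained; this makes the inequality
          strict.\<close>
        moreover have "i < l \<or> j < ?k - l" using l by auto
        then have "w * l + \<delta> (coeff p l) < poly_degfun w \<delta> p
          \<or> w * (?k - l) + \<delta> (coeff q (?k - l)) < poly_degfun w \<delta> q"
          using i(3) j(3) False by blast
        ultimately have "\<delta> (coeff p l) + \<delta> (coeff q (?k - l)) < \<delta> (coeff p i) + \<delta> (coeff q j)"
          using wk i(2) j(2) by linarith
        then show ?thesis using a(2) degfun_mult[OF \<delta>] False by auto
      qed auto
    qed
    from degfun_add_lower[OF \<delta> a(1) this]
    have "coeff (p * q) ?k \<noteq> 0" "\<delta> (coeff (p * q) ?k) = \<delta> (coeff p i) + \<delta> (coeff q j)"
      unfolding split using a(2) by auto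
    then show "poly_degfun w \<delta> p + poly_degfun w \<delta> q \<le> poly_degfun w \<delta> (p * q)"
      using poly_degfun_ge[of "p * q" ?k w \<delta>] i(2) j(2) by (simp add: algebra_simps)
  qed
qed

lemma poly_degfun_const: "degfun \<delta> \<Longrightarrow> poly_degfun w \<delta> [:a:] = \<delta> a"
  by (rule antisym)
    (auto simp: poly_degfun_le_iff coeff_pCons degfun_0 split: nat.splits
      intro: poly_degfun_ge[of "[:a:]" 0 w \<delta>, simplified] simp del: coeff_pCons_0,
     metis coeff_pCons_0 degfun_0 mult_0_right plus_nat.add_0 poly_degfun_ge zero_le)

lemma degfun_coeff_le: "degfun \<delta> \<Longrightarrow> \<delta> (coeff p i) \<le> poly_degfun w \<delta> p"
  using poly_degfun_ge[of p i w \<delta>] degfun_0[of \<delta>] by (cases "coeff p i = 0") auto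

lemma poly_degfun_0_le_iff: "degfun \<delta> \<Longrightarrow> poly_degfun 0 \<delta> p \<le> n \<longleftrightarrow> (\<forall>i. \<delta> (coeff p i) \<le> n)"
  unfolding poly_degfun_le_iff using degfun_0[of \<delta>] by (metis mult_0 plus_nat.add_0 zero_le)

section \<open>Unique factorization\<close>

text \<open>
  Unique factorization in the subring \<open>{x. \<delta> x = 0}\<close>, which contains all divisors of its nonzero
  elements. Relativizing to such subrings allows an induction on the number of indeterminates within
  a single polynomial type.
\<close>

definition additive_length :: "('a::idom \<Rightarrow> nat) \<Rightarrow> bool" where
  "additive_length l \<longleftrightarrow> (\<forall>a b. a \<noteq> 0 \<longrightarrow> b \<noteq> 0 \<longrightarrow> l (a * b) = l a + l b) \<and>
     (\<forall>a. a \<noteq> 0 \<longrightarrow> l a = 0 \<longrightarrow> a dvd 1)"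

text \<open>The length provides factorizations, primality of irreducibles their uniqueness.
  Irreducibility is meant in the whole type, which agrees with the subring because divisors of its
  nonzero elements stay in it.\<close>

definition factorial_on :: "('a::idom \<Rightarrow> nat) \<Rightarrow> bool" where
  "factorial_on \<delta> \<longleftrightarrow> degfun \<delta> \<and> (\<exists>l::'a \<Rightarrow> nat. additive_length l) \<and>
     (\<forall>p a b. \<delta> p = 0 \<longrightarrow> \<delta> a = 0 \<longrightarrow> \<delta> b = 0 \<longrightarrow> irreducible p \<longrightarrow> p dvd a * b \<longrightarrow> p dvd a \<or> p dvd b)"

lemma factorial_onI:
  assumes "degfun (\<delta> :: 'a::idom \<Rightarrow> nat)" "additive_length (l :: 'a \<Rightarrow> nat)"
    and "\<And>p a b. \<delta> p = 0 \<Longrightarrow> \<delta> a = 0 \<Longrightarrow> \<delta> b = 0 \<Longrightarrow> irreducible p \<Longrightarrow> p dvd a * b \<Longrightarrow> p dvd a \<or> p dvd b"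
  shows "factorial_on \<delta>"
  using assms unfolding factorial_on_def by blast

lemma factorial_onD:
  assumes "factorial_on (\<delta> :: 'a::idom \<Rightarrow> nat)"
  shows "degfun \<delta>" "\<exists>l::'a \<Rightarrow> nat. additive_length l"
    "irreducible p \<Longrightarrow> p dvd a * b \<Longrightarrow> \<delta> p = 0 \<Longrightarrow> \<delta> a = 0 \<Longrightarrow> \<delta> b = 0 \<Longrightarrow> p dvd a \<or> p dvd b"
  using assms unfolding factorial_on_def by blast+

lemma additive_length_unit_iff:
  fixes a :: "'a::idom"
  assumes l: "additive_length l" and "a \<noteq> 0"
  shows "a dvd 1 \<longleftrightarrow> l a = 0"
proof
  assume "a dvd 1"
  then obtain b where ab: "1 = a * b" by (auto elim: dvdE)
  then have "b \<noteq> 0" by auto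
  moreover have "l (1 * 1) = l 1 + l 1" using l unfolding additive_length_def by (metis zero_neq_one)
  ultimately show "l a = 0" using l ab \<open>a \<noteq> 0\<close> unfolding additive_length_def by (metis add_is_0 add_cancel_left_left mult_1)
qed (use assms additive_length_def in blast)

lemma irreducible_dvd_exists:
  fixes a :: "'a::idom"
  assumes l: "additive_length (l :: 'a \<Rightarrow> nat)"
  shows "a \<noteq> 0 \<Longrightarrow> \<not> a dvd 1 \<Longrightarrow> \<exists>p. irreducible p \<and> p dvd a"
proof (induction "l a" arbitrary: a rule: less_induct)
  case less
  show ?case
  proof (cases "irreducible a")
    case False
    then obtain b c where bc: "a = b * c" "\<not> b dvd 1" "\<not> c dvd 1"
      using less.prems unfolding irreducible_def by blast
    then have nz: "b \<noteq> 0" "c \<noteq> 0" using less.prems by auto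
    then have "l a = l b + l c" "l c \<noteq> 0"
      using l bc additive_length_unit_iff[OF l] unfolding additive_length_def by blast+
    then obtain p where "irreducible p" "p dvd b" using less.hyps[of b] bc nz by auto
    then show ?thesis using bc(1) by auto
  qed auto
qed

text \<open>Takes the place of explicit factorizations: removing an irreducible factor lowers the
  length, so a unit is reached after finitely many steps.\<close>

lemma irreducible_induct [consumes 2, case_names unit irreducible]:
  assumes l: "\<exists>l::'a::idom \<Rightarrow> nat. additive_length l" and "a \<noteq> 0"
    and unit: "\<And>u. u dvd 1 \<Longrightarrow> P u"
    and irr: "\<And>p a. irreducible p \<Longrightarrow> a \<noteq> 0 \<Longrightarrow> P a \<Longrightarrow> P (p * a)"
  shows "P (a::'a)"
proof -
  obtain l :: "'a \<Rightarrow> nat" where l: "additive_length l" using assms by blast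
  show ?thesis using \<open>a \<noteq> 0\<close>
  proof (induction "l a" arbitrary: a rule: less_induct)
    case less
    show ?case
    proof (cases "a dvd 1")
      case False
      then obtain p where p: "irreducible p" "p dvd a"
        using irreducible_dvd_exists[OF l] less.prems by blast
      then obtain b where b: "a = p * b" by (auto elim: dvdE)
      have nz: "p \<noteq> 0" "b \<noteq> 0" using b less.prems by auto
      then have "l a = l p + l b" "l p \<noteq> 0"
        using l b p additive_length_unit_iff[OF l, of p]
        unfolding additive_length_def irreducible_def by blast+
      then have "P b" using less.hyps nz by simp
      then show ?thesis using irr p nz b by simp
    qed (rule unit)
  qed
qed

section \<open>The subring of degree zero, Gauss's lemma and pseudo-division\<close>

lemma degfun_zero_closed:
  assumes "degfun \<delta>" "\<delta> a = 0" "\<delta> b = 0"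
  shows "\<delta> (a + b) = 0" "\<delta> (a - b) = 0" "\<delta> (a * b) = 0"
  using degfun_add_le_max[OF assms(1), of a b] degfun_diff_le_max[OF assms(1), of a b]
    degfun_mult_le[OF assms(1), of a b] assms by auto

lemma degfun_zero_factor:
  assumes "degfun \<delta>" "\<delta> (a * b) = 0" "a * b \<noteq> 0"
  shows "\<delta> a = 0" "\<delta> b = 0"
  using degfun_mult[OF assms(1), of a b] assms by auto

lemma poly_degfun_smult:
  assumes "degfun \<delta>" "\<delta> c = 0" "poly_degfun 0 \<delta> p = 0"
  shows "poly_degfun 0 \<delta> (smult c p) = 0"
  using degfun_zero_closed(3)[OF degfun_poly_degfun[OF assms(1), of 0], of "[:c:]" p]
    poly_degfun_const[OF assms(1), of 0 c] assms by simp

lemma poly_degfun_monom: "degfun \<delta> \<Longrightarrow> \<delta> c = 0 \<Longrightarrow> poly_degfun 0 \<delta> (Polynomial.monom c n) = 0"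
  using poly_degfun_0_le_iff[of \<delta> "Polynomial.monom c n" 0] by (auto simp: coeff_monom degfun_0)

text \<open>Gauss's lemma for a constant prime: modulo \<open>p\<close>, the product of the first
  coefficients of \<open>g\<close> and \<open>h\<close> not divisible by \<open>p\<close> is a
  coefficient of \<open>g * h\<close>.\<close>

lemma const_poly_dvd_mult_on:
  assumes \<delta>: "degfun \<delta>"
    and p: "\<And>a b. \<delta> a = 0 \<Longrightarrow> \<delta> b = 0 \<Longrightarrow> p dvd a * b \<Longrightarrow> p dvd a \<or> p dvd b"
    and gh: "poly_degfun 0 \<delta> g = 0" "poly_degfun 0 \<delta> h = 0" "[:p:] dvd g * h"
  shows "[:p:] dvd g \<or> [:p:] dvd h"
proof (rule ccontr)
  assume "\<not> ?thesis"
  then have ex: "\<exists>i. \<not> p dvd coeff g i" "\<exists>j. \<not> p dvd coeff h j" by (auto simp: const_poly_dvd_iff)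
  obtain i where i: "\<not> p dvd coeff g i" "\<And>k. k < i \<Longrightarrow> p dvd coeff g k"
    using ex(1) exists_least_iff[of "\<lambda>i. \<not> p dvd coeff g i"] by blast
  obtain j where j: "\<not> p dvd coeff h j" "\<And>k. k < j \<Longrightarrow> p dvd coeff h k"
    using ex(2) exists_least_iff[of "\<lambda>j. \<not> p dvd coeff h j"] by blast
  have "p dvd coeff (g * h) (i + j)" using gh(3) by (simp add: const_poly_dvd_iff)
  also have "coeff (g * h) (i + j) =
      coeff g i * coeff h j + (\<Sum>k\<in>{..i + j} - {i}. coeff g k * coeff h (i + j - k))"
    unfolding coeff_mult by (subst sum.remove[of _ i]) auto
  finally have "p dvd coeff g i * coeff h j + (\<Sum>k\<in>{..i + j} - {i}. coeff g k * coeff h (i + j - k))" .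
  moreover have "p dvd (\<Sum>k\<in>{..i + j} - {i}. coeff g k * coeff h (i + j - k))"
  proof (rule dvd_sum)
    fix k assume "k \<in> {..i + j} - {i}"
    then have "k < i \<or> i + j - k < j" by auto
    then show "p dvd coeff g k * coeff h (i + j - k)" using i(2) j(2) by fastforce
  qed
  ultimately have "p dvd coeff g i * coeff h j" by (simp add: dvd_add_left_iff)
  moreover have "\<delta> (coeff g i) = 0" "\<delta> (coeff h j) = 0"
    using poly_degfun_0_le_iff[OF \<delta>, of _ 0] gh by auto
  ultimately show False using p i(1) j(1) by blast
qed

text \<open>The leading coefficient of \<open>r\<close> is not invertible in general, so each
  division step multiplies \<open>f\<close> by it; \<open>c\<close> collects these
  multipliers.\<close>

lemma pseudo_division_on:
  assumes \<delta>: "degfun \<delta>" and "r \<noteq> 0" and r: "poly_degfun 0 \<delta> r = 0"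
  shows "poly_degfun 0 \<delta> f = 0 \<Longrightarrow> \<exists>c q s. c \<noteq> 0 \<and> \<delta> c = 0 \<and> poly_degfun 0 \<delta> q = 0 \<and>
     poly_degfun 0 \<delta> s = 0 \<and> smult c f = q * r + s \<and> (s = 0 \<or> degree s < degree r)"
proof (induction "degree f" arbitrary: f rule: less_induct)
  case less
  note \<Delta> = degfun_poly_degfun[OF \<delta>, of 0]
  have coeff_0: "\<delta> (coeff p i) = 0" if "poly_degfun 0 \<delta> p = 0" for p i
    using poly_degfun_0_le_iff[OF \<delta>, of p 0] that by auto
  show ?case
  proof (cases "f = 0 \<or> degree f < degree r")
    case True
    then show ?thesis using less.prems degfun_1[OF \<delta>] degfun_0[OF \<Delta>]
      by (intro exI[of _ 1] exI[of _ 0] exI[of _ f]) auto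
  next
    case False
    define t where "t = Polynomial.monom (lead_coeff f) (degree f - degree r)"
    define f' where "f' = smult (lead_coeff r) f - t * r"
    have t: "poly_degfun 0 \<delta> t = 0"
      unfolding t_def by (rule poly_degfun_monom[OF \<delta>]) (rule coeff_0[OF less.prems])
    have f': "poly_degfun 0 \<delta> f' = 0"
      unfolding f'_def
      by (intro degfun_zero_closed[OF \<Delta>] poly_degfun_smult[OF \<delta>] coeff_0 less.prems r t)
    have "degree (t * r) \<le> degree f"
      using False degree_mult_le[of t r] degree_monom_le[of "lead_coeff f" "degree f - degree r"]
      unfolding t_def by linarith
    then have "degree f' \<le> degree f" unfolding f'_def by (intro degree_diff_le) auto
    moreover have "coeff f' (degree f) = 0"
    proof -
      have "coeff (t * r) (degree f - degree r + degree r) = lead_coeff f * lead_coeff r"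
        unfolding t_def by (simp only: coeff_monom_mult) simp
      then show ?thesis unfolding f'_def using False by (simp add: mult.commute)
    qed
    ultimately have "f' = 0 \<or> degree f' < degree f" by (intro eq_zero_or_degree_less) auto
    then obtain c q s where cqs: "c \<noteq> 0" "\<delta> c = 0" "poly_degfun 0 \<delta> q = 0"
      "poly_degfun 0 \<delta> s = 0" "smult c f' = q * r + s" "s = 0 \<or> degree s < degree r"
    proof
      assume "f' = 0"
      then show thesis using degfun_1[OF \<delta>] degfun_0[OF \<Delta>] by (intro that[of 1 0 0]) auto
    next
      assume "degree f' < degree f"
      then show thesis using less.hyps[of f'] f' that by blast
    qed
    show ?thesis
    proof (intro exI conjI)
      show "c * lead_coeff r \<noteq> 0" using cqs(1) \<open>r \<noteq> 0\<close> by simp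
      show "\<delta> (c * lead_coeff r) = 0" by (intro degfun_zero_closed[OF \<delta>] cqs coeff_0 r)
      show "poly_degfun 0 \<delta> (q + smult c t) = 0"
        by (intro degfun_zero_closed[OF \<Delta>] poly_degfun_smult[OF \<delta>] cqs t)
      show "smult (c * lead_coeff r) f = (q + smult c t) * r + s"
        using cqs(5) unfolding f'_def by (simp add: algebra_simps smult_diff_right)
    qed (use cqs in auto)
  qed
qed

context
  fixes \<delta> :: "'a::idom \<Rightarrow> nat" and f :: "'a poly"
  assumes \<delta>: "factorial_on \<delta>"
    and irr: "irreducible f" and deg: "degree f > 0" and f: "poly_degfun 0 \<delta> f = 0"
begin

text \<open>This is primitivity of \<open>f\<close>: next to a constant irreducible factor the other
  factor would be a unit, and \<open>f\<close> would have degree 0.\<close>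

lemma irreducible_poly_const_not_dvd: "irreducible p \<Longrightarrow> \<not> [:p:] dvd f"
proof
  assume p: "irreducible p" "[:p:] dvd f"
  then obtain g where g: "f = [:p:] * g" by (auto elim: dvdE)
  then have "[:p:] dvd 1 \<or> g dvd 1" using irr unfolding irreducible_def by blast
  moreover have "\<not> [:p:] dvd 1" using p by (auto simp: irreducible_def is_unit_const_poly_iff)
  ultimately have "g dvd 1" by blast
  then have "degree g = 0" using dvd_imp_degree_le[of g 1] by simp
  then show False using deg g degree_mult_le[of "[:p:]" g] by simp
qed

lemma const_dvd_mult_cases:
  assumes "irreducible p" "\<delta> p = 0" "poly_degfun 0 \<delta> g = 0" "poly_degfun 0 \<delta> h = 0" "[:p:] dvd g * h"
  shows "[:p:] dvd g \<or> [:p:] dvd h"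
  using assms \<delta> unfolding factorial_on_def by (intro const_poly_dvd_mult_on[of \<delta>]) blast+

text \<open>By Gauss's lemma an irreducible factor of \<open>c\<close> divides \<open>f\<close> or
  the quotient. As \<open>f\<close> is primitive it divides the quotient, so the factors of
  \<open>c\<close> cancel one at a time.\<close>

lemma irreducible_poly_dvd_smult:
  assumes "c \<noteq> 0"
  shows "\<delta> c = 0 \<Longrightarrow> poly_degfun 0 \<delta> g = 0 \<Longrightarrow> f dvd smult c g \<Longrightarrow> f dvd g"
proof -
  have l: "\<exists>l::'a \<Rightarrow> nat. additive_length l" and d: "degfun \<delta>"
    using \<delta> unfolding factorial_on_def by blast+
  note \<Delta> = degfun_poly_degfun[OF d, of 0]
  show "\<delta> c = 0 \<Longrightarrow> poly_degfun 0 \<delta> g = 0 \<Longrightarrow> f dvd smult c g \<Longrightarrow> f dvd g"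
    using l assms
  proof (induction c rule: irreducible_induct)
    case (unit u)
    then obtain v where v: "1 = u * v" by (auto elim: dvdE)
    have "f dvd smult v (smult u g)" using unit by (simp only: dvd_smult)
    also have "smult v (smult u g) = g" using v by (simp add: mult.commute)
    finally show ?case .
  next
    case (irreducible p a)
    have pa: "\<delta> p = 0" "\<delta> a = 0"
      using degfun_zero_factor[OF d, of p a] irreducible by (auto simp: irreducible_def)
    obtain w where w: "smult (p * a) g = f * w" using irreducible.prems by (metis dvdE)
    have "f dvd smult a g"
    proof (cases "g = 0")
      case False
      then have "f * w \<noteq> 0" using w irreducible by (metis irreducible_def mult_eq_0_iff smult_eq_0_iff)
      moreover have "poly_degfun 0 \<delta> (f * w) = 0"
        unfolding w[symmetric] by (intro poly_degfun_smult[OF d] irreducible.prems)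
      ultimately have "poly_degfun 0 \<delta> w = 0" using degfun_zero_factor[OF \<Delta>] by blast
      moreover have "[:p:] dvd f * w" unfolding w[symmetric] by (auto simp: const_poly_dvd_iff)
      ultimately have "[:p:] dvd w"
        using const_dvd_mult_cases[OF irreducible.hyps(1) pa(1) f]
          irreducible_poly_const_not_dvd[OF irreducible.hyps(1)] by blast
      then obtain w' where "w = [:p:] * w'" by (auto elim: dvdE)
      then have "smult p (smult a g) = smult p (f * w')" using w by simp
      then have "smult a g = f * w'" using irreducible.hyps(1)
        by (metis irreducible_def smult_cancel)
      then show ?thesis by simp
    qed simp
    then show ?case using irreducible pa by blast
  qed
qed

text \<open>Takes the place of the fraction field: each irreducible factor of \<open>c\<close>
  divides \<open>q\<close> or \<open>r\<close> and is removed there, until a factorization of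
  \<open>f\<close> itself is left, to which irreducibility applies.\<close>

lemma irreducible_poly_smult_factor:
  assumes "c \<noteq> 0"
  shows "\<delta> c = 0 \<Longrightarrow> poly_degfun 0 \<delta> q = 0 \<Longrightarrow> poly_degfun 0 \<delta> r = 0 \<Longrightarrow> smult c f = q * r \<Longrightarrow>
    \<exists>a b q' r'. f = q' * r' \<and> q = smult a q' \<and> r = smult b r'"
proof -
  have l: "\<exists>l::'a \<Rightarrow> nat. additive_length l" and d: "degfun \<delta>"
    using \<delta> unfolding factorial_on_def by blast+
  note \<Delta> = degfun_poly_degfun[OF d, of 0]
  show "\<delta> c = 0 \<Longrightarrow> poly_degfun 0 \<delta> q = 0 \<Longrightarrow> poly_degfun 0 \<delta> r = 0 \<Longrightarrow> smult c f = q * r \<Longrightarrow>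
    \<exists>a b q' r'. f = q' * r' \<and> q = smult a q' \<and> r = smult b r'"
    using l assms
  proof (induction c arbitrary: q r rule: irreducible_induct)
    case (unit u)
    then obtain v where v: "1 = v * u" by (metis dvdE mult.commute)
    have "f = smult v (smult u f)" using v by simp
    also have "\<dots> = smult v q * r" using unit by simp
    finally have "f = smult v q * r" .
    moreover have "q = smult u (smult v q)" using v by (simp add: mult.commute)
    ultimately show ?case by (intro exI[of _ u] exI[of _ 1] exI[of _ "smult v q"] exI[of _ r]) auto
  next
    case (irreducible p a)
    have p0: "p \<noteq> 0" and f0: "f \<noteq> 0" using irreducible irr by (auto simp: irreducible_def)
    have pa: "\<delta> p = 0" "\<delta> a = 0" using degfun_zero_factor[OF d, of p a] irreducible p0 by auto
    have qr0: "q * r \<noteq> 0" using irreducible p0 f0 by (metis mult_eq_0_iff smult_eq_0_iff)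
    have "[:p:] dvd q * r" unfolding irreducible.prems(4)[symmetric] by (auto simp: const_poly_dvd_iff)
    then have "[:p:] dvd q \<or> [:p:] dvd r"
      using const_dvd_mult_cases irreducible pa by blast
    then show ?case
    proof
      assume "[:p:] dvd q"
      then obtain s where s: "q = [:p:] * s" by (auto elim: dvdE)
      then have "smult p (smult a f) = smult p (s * r)" using irreducible by simp
      then have "smult a f = s * r" using p0 by (metis smult_cancel)
      moreover have "poly_degfun 0 \<delta> s = 0"
        using degfun_zero_factor(2)[OF \<Delta>, of "[:p:]" s] s qr0 irreducible.prems by auto
      ultimately obtain b1 b2 q' r' where "f = q' * r'" "s = smult b1 q'" "r = smult b2 r'"
        using irreducible pa by blast
      moreover from this have "q = smult (p * b1) q'" using s by (simp add: mult.commute)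
      ultimately show ?thesis by blast
    next
      assume "[:p:] dvd r"
      then obtain s where s: "r = [:p:] * s" by (auto elim: dvdE)
      then have "smult p (smult a f) = smult p (q * s)" using irreducible by simp
      then have "smult a f = q * s" using p0 by (metis smult_cancel)
      moreover have "poly_degfun 0 \<delta> s = 0"
        using degfun_zero_factor(2)[OF \<Delta>, of "[:p:]" s] s qr0 irreducible.prems by auto
      ultimately obtain b1 b2 q' r' where "f = q' * r'" "q = smult b1 q'" "s = smult b2 r'"
        using irreducible pa by blast
      moreover from this have "r = smult (p * b2) r'" using s by (simp add: mult.commute)
      ultimately show ?thesis by blast
    qed
  qed
qed

text \<open>
  An element \<open>r\<close> of minimal degree in the ideal generated by \<open>f\<close> and \<open>g\<close> divides both up to a
  constant factor; since \<open>f\<close> is irreducible, \<open>r\<close> is a constant or a constant multiple of \<open>f\<close>.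
\<close>

lemma irreducible_poly_dvd_mult_on:
  assumes g: "poly_degfun 0 \<delta> g = 0" and h: "poly_degfun 0 \<delta> h = 0" and dvd: "f dvd g * h"
  shows "f dvd g \<or> f dvd h"
proof -
  have d: "degfun \<delta>" using \<delta> unfolding factorial_on_def by blast
  note \<Delta> = degfun_poly_degfun[OF d, of 0]
  define I where "I = {\<alpha> * f + \<beta> * g | \<alpha> \<beta>. poly_degfun 0 \<delta> \<alpha> = 0 \<and> poly_degfun 0 \<delta> \<beta> = 0}"
  have I_on: "poly_degfun 0 \<delta> x = 0" if "x \<in> I" for x
    using that unfolding I_def by (auto intro!: degfun_zero_closed[OF \<Delta>] f g)
  have "1 * f + 0 * g \<in> I" unfolding I_def using degfun_0[OF \<Delta>] degfun_1[OF \<Delta>] by blast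
  then have fI: "f \<in> I" by simp
  have "0 * f + 1 * g \<in> I" unfolding I_def using degfun_0[OF \<Delta>] degfun_1[OF \<Delta>] by blast
  then have gI: "g \<in> I" by simp
  have "f \<noteq> 0" using irr by (auto simp: irreducible_def)
  then have "\<exists>r. r \<in> I \<and> r \<noteq> 0" using fI by blast
  then obtain r where r: "r \<in> I" "r \<noteq> 0" and min: "\<And>s. s \<in> I \<Longrightarrow> s \<noteq> 0 \<Longrightarrow> degree r \<le> degree s"
    using ex_has_least_nat[of "\<lambda>r. r \<in> I \<and> r \<noteq> 0" _ degree] by blast
  \<comment> \<open>Pseudo-division by \<open>r\<close> leaves a remainder in \<open>I\<close>,
    which vanishes because \<open>r\<close> has minimal degree.\<close>
  have pdiv: "\<exists>c q. c \<noteq> 0 \<and> \<delta> c = 0 \<and> poly_degfun 0 \<delta> q = 0 \<and> smult c x = q * r" if x: "x \<in> I" for x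
  proof -
    obtain c q s where cqs: "c \<noteq> 0" "\<delta> c = 0" "poly_degfun 0 \<delta> q = 0"
      "smult c x = q * r + s" "s = 0 \<or> degree s < degree r"
      using pseudo_division_on[OF d r(2) I_on[OF r(1)] I_on[OF x]] by blast
    obtain \<alpha>1 \<beta>1 where x_eq: "x = \<alpha>1 * f + \<beta>1 * g" "poly_degfun 0 \<delta> \<alpha>1 = 0" "poly_degfun 0 \<delta> \<beta>1 = 0"
      using x unfolding I_def by blast
    obtain \<alpha>2 \<beta>2 where r_eq: "r = \<alpha>2 * f + \<beta>2 * g" "poly_degfun 0 \<delta> \<alpha>2 = 0" "poly_degfun 0 \<delta> \<beta>2 = 0"
      using r unfolding I_def by blast
    have "s = smult c x - q * r" using cqs(4) by simp
    also have "\<dots> = (smult c \<alpha>1 - q * \<alpha>2) * f + (smult c \<beta>1 - q * \<beta>2) * g"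
      unfolding x_eq r_eq by (simp add: algebra_simps smult_add_right)
    finally have "s \<in> I" unfolding I_def
      by (auto intro!: exI degfun_zero_closed[OF \<Delta>] poly_degfun_smult[OF d] cqs x_eq r_eq)
    then show ?thesis using cqs min[of s] by force
  qed
  obtain c q where cq: "c \<noteq> 0" "\<delta> c = 0" "poly_degfun 0 \<delta> q = 0" "smult c f = q * r"
    using pdiv[OF fI] by blast
  obtain a b q' r' where ab: "f = q' * r'" "q = smult a q'" "r = smult b r'"
    using irreducible_poly_smult_factor[OF cq(1,2,3) I_on[OF r(1)] cq(4)] by blast
  \<comment> \<open>If \<open>q'\<close> is a unit, then \<open>f\<close> divides \<open>r\<close>
    and hence a constant multiple of \<open>g\<close>. If \<open>r'\<close> is a unit, then
    \<open>r\<close> is a constant, and multiplying its representation in \<open>I\<close> by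
    \<open>h\<close> shows that \<open>f\<close> divides a constant multiple of
    \<open>h\<close>.\<close>
  consider "q' dvd 1" | "r' dvd 1" using irr ab(1) unfolding irreducible_def by blast
  then show ?thesis
  proof cases
    case 1
    then have "f dvd r'" using ab(1) by (metis dvd_refl mult_dvd_mono mult_1)
    obtain c q where cq: "c \<noteq> 0" "\<delta> c = 0" "smult c g = q * r" using pdiv[OF gI] by blast
    have "f dvd smult c g" using \<open>f dvd r'\<close> unfolding cq(3) ab(3) by (simp add: dvd_smult)
    then show ?thesis using irreducible_poly_dvd_smult[OF cq(1,2) g] by blast
  next
    case 2
    then have "degree r' = 0" using dvd_imp_degree_le[of r' 1] by simp
    then have "degree r = 0" using ab(3) degree_smult_le[of b r'] by simp
    then obtain e where e: "r = [:e:]" by (rule degree_eq_zeroE)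
    then have e0: "e \<noteq> 0" "\<delta> e = 0" using r I_on[OF r(1)] poly_degfun_const[OF d, of 0 e] by auto
    obtain \<alpha> \<beta> where "r = \<alpha> * f + \<beta> * g" using r unfolding I_def by blast
    then have "r * h = \<alpha> * h * f + \<beta> * (g * h)" by (simp add: algebra_simps)
    then have "smult e h = \<alpha> * h * f + \<beta> * (g * h)" using e by simp
    then have "f dvd smult e h" using dvd by simp
    then show ?thesis using irreducible_poly_dvd_smult[OF e0 h] by blast
  qed
qed

end

lemma factorial_on_poly:
  assumes \<delta>: "factorial_on \<delta>"
  shows "factorial_on (poly_degfun 0 \<delta>)"
  unfolding factorial_on_def
proof (intro conjI allI impI)
  have d: "degfun \<delta>" using \<delta> unfolding factorial_on_def by blast
  show "degfun (poly_degfun 0 \<delta>)" by (rule degfun_poly_degfun[OF d])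
  obtain l :: "'a \<Rightarrow> nat" where l: "additive_length l" using \<delta> unfolding factorial_on_def by blast
  \<comment> \<open>The sum vanishes only for a constant whose own length is zero, that is, for a
    unit.\<close>
  have "additive_length (\<lambda>p. degree p + l (lead_coeff p))"
    unfolding additive_length_def
  proof (intro conjI allI impI)
    fix p q :: "'a poly" assume "p \<noteq> 0" "q \<noteq> 0"
    then show "degree (p * q) + l (lead_coeff (p * q)) =
        degree p + l (lead_coeff p) + (degree q + l (lead_coeff q))"
      using l unfolding additive_length_def lead_coeff_mult by (simp add: degree_mult_eq)
  next
    fix p :: "'a poly" assume p: "p \<noteq> 0" "degree p + l (lead_coeff p) = 0"
    then obtain c where "p = [:c:]" by (metis add_is_0 degree_eq_zeroE)
    then show "p dvd 1" using p l unfolding additive_length_def by (auto simp: is_unit_const_poly_iff)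
  qed
  then show "\<exists>l::'a poly \<Rightarrow> nat. additive_length l" by blast
  fix f g h :: "'a poly"
  assume on: "poly_degfun 0 \<delta> f = 0" "poly_degfun 0 \<delta> g = 0" "poly_degfun 0 \<delta> h = 0"
    and irr: "irreducible f" and dvd: "f dvd g * h"
  show "f dvd g \<or> f dvd h"
  proof (cases "degree f = 0")
    case True
    then obtain p where p: "f = [:p:]" by (rule degree_eq_zeroE)
    have "irreducible p" using irr unfolding p by (simp add: irreducible_const_poly_iff)
    moreover have "\<delta> p = 0" using on(1) poly_degfun_const[OF d] unfolding p by simp
    ultimately show ?thesis
      using const_poly_dvd_mult_on[OF d _ on(2,3), of p] dvd \<delta> unfolding p factorial_on_def by blast
  next
    case False
    then show ?thesis using irreducible_poly_dvd_mult_on[OF \<delta> irr _ on] dvd by simp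
  qed
qed

section \<open>Multivariate polynomials\<close>

abbreviation mconst :: "'a::zero \<Rightarrow> ('v, 'a) mpoly" where
  "mconst \<equiv> Poly_Mapping.single 0"

definition mvar :: "'v \<Rightarrow> ('v, 'a::zero_neq_one) mpoly" where
  "mvar v = Poly_Mapping.single (Poly_Mapping.single v 1) 1"

text \<open>The common form of \<open>ev\<close>, \<open>ev_int\<close>, \<open>grading\<close> and
  \<open>split_var\<close>, so that the homomorphism property is proved once for all of
  them.\<close>

definition mpoly_eval ::
  "('a::zero \<Rightarrow> 'b) \<Rightarrow> ('v \<Rightarrow> 'b::comm_ring_1) \<Rightarrow> ('v, 'a) mpoly \<Rightarrow> 'b" where
  "mpoly_eval h x p = (\<Sum>m\<in>Poly_Mapping.keys p. h (Poly_Mapping.lookup p m) * mon_eval x m)"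

section \<open>Evaluation as a ring homomorphism\<close>

lemma mon_eval_superset:
  "finite V \<Longrightarrow> Poly_Mapping.keys m \<subseteq> V \<Longrightarrow> mon_eval x m = (\<Prod>v\<in>V. x v ^ Poly_Mapping.lookup m v)"
  unfolding mon_eval_def by (rule prod.mono_neutral_left) (auto simp: in_keys_iff)

lemma mon_eval_0: "mon_eval x 0 = 1"
  by (simp add: mon_eval_def)

lemma mon_eval_single: "mon_eval x (Poly_Mapping.single v 1) = x v"
  by (simp add: mon_eval_def)

lemma mon_eval_add: "mon_eval x (m + m') = mon_eval x m * mon_eval x m'"
proof -
  let ?V = "Poly_Mapping.keys m \<union> Poly_Mapping.keys m'"
  have "Poly_Mapping.keys (m + m') \<subseteq> ?V" by (rule keys_add)
  then show ?thesis
    by (simp add: mon_eval_superset[of ?V] lookup_add power_add prod.distrib)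
qed

lemma mpoly_eval_superset:
  assumes "h 0 = 0" "finite M" "Poly_Mapping.keys p \<subseteq> M"
  shows "mpoly_eval h x p = (\<Sum>m\<in>M. h (Poly_Mapping.lookup p m) * mon_eval x m)"
  unfolding mpoly_eval_def using assms by (intro sum.mono_neutral_left) (auto simp: in_keys_iff)

lemma mpoly_sum_single:
  "p = (\<Sum>m\<in>Poly_Mapping.keys p. Poly_Mapping.single m (Poly_Mapping.lookup p m))"
  by (rule poly_mapping_eqI)
    (auto simp: lookup_sum lookup_single when_def sum.delta' in_keys_iff)

lemma comm_ring_hom_mpoly_eval:
  fixes h :: "'a::comm_ring_1 \<Rightarrow> 'b::comm_ring_1"
  assumes "comm_ring_hom h"
  shows "comm_ring_hom (mpoly_eval h x)"
proof -
  interpret h: comm_ring_hom h by fact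
  have single: "mpoly_eval h x (Poly_Mapping.single m c) = h c * mon_eval x m" for m c
    by (simp add: mpoly_eval_superset[of h "{m}"])
  have add: "mpoly_eval h x (p + q) = mpoly_eval h x p + mpoly_eval h x q" for p q
  proof -
    let ?M = "Poly_Mapping.keys p \<union> Poly_Mapping.keys q"
    have "Poly_Mapping.keys (p + q) \<subseteq> ?M" by (rule keys_add)
    then show ?thesis
      by (simp add: mpoly_eval_superset[of h ?M] lookup_add h.hom_add distrib_right sum.distrib)
  qed
  have zero: "mpoly_eval h x 0 = 0" by (simp add: mpoly_eval_def)
  have sum: "mpoly_eval h x (sum f I) = (\<Sum>i\<in>I. mpoly_eval h x (f i))" for f and I :: "'i set"
    by (induction I rule: infinite_finite_induct) (auto simp: zero add)
  have mult: "mpoly_eval h x (p * q) = mpoly_eval h x p * mpoly_eval h x q" for p q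
  proof -
    have "p * q = (\<Sum>m\<in>Poly_Mapping.keys p. \<Sum>m'\<in>Poly_Mapping.keys q.
        Poly_Mapping.single (m + m') (Poly_Mapping.lookup p m * Poly_Mapping.lookup q m'))"
      by (subst mpoly_sum_single[of p], subst mpoly_sum_single[of q])
        (simp only: sum_product mult_single)
    then show ?thesis
      by (simp only: sum single)
        (simp add: mpoly_eval_def sum_product mon_eval_add h.hom_mult mult_ac)
  qed
  show ?thesis
    by unfold_locales
      (auto simp: zero add mult single[of 0 1, simplified] mon_eval_0)
qed

lemma hom_mon_eval:
  assumes "comm_ring_hom g"
  shows "g (mon_eval x m) = mon_eval (\<lambda>v. g (x v)) m"
proof -
  interpret comm_ring_hom g by fact
  show ?thesis by (simp add: mon_eval_def hom_distribs)
qed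

lemma hom_mpoly_eval:
  assumes "comm_ring_hom g"
  shows "g (mpoly_eval h x p) = mpoly_eval (\<lambda>c. g (h c)) (\<lambda>v. g (x v)) p"
proof -
  interpret comm_ring_hom g by fact
  show ?thesis by (simp add: mpoly_eval_def hom_distribs hom_mon_eval[OF assms])
qed

lemma mpoly_eval_cong:
  assumes "\<And>m v. m \<in> Poly_Mapping.keys p \<Longrightarrow> v \<in> Poly_Mapping.keys m \<Longrightarrow> x v = y v"
  shows "mpoly_eval h x p = mpoly_eval h y p"
  unfolding mpoly_eval_def mon_eval_def using assms by (auto intro!: sum.cong prod.cong)

lemma mvar_power: "mvar v ^ n = Poly_Mapping.single (Poly_Mapping.single v n) (1::'a::comm_ring_1)"
  by (induction n) (auto simp: mvar_def mult_single single_add[symmetric])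

lemma mon_eval_mvar: "mon_eval mvar m = Poly_Mapping.single m (1::'a::comm_ring_1)"
proof -
  have prod: "(\<Prod>v\<in>V. Poly_Mapping.single (f v) 1) = Poly_Mapping.single (sum f V) (1::'a)"
    for V :: "'v set" and f :: "'v \<Rightarrow> 'v monom"
    by (induction V rule: infinite_finite_induct) (auto simp: mult_single)
  show ?thesis
    unfolding mon_eval_def using mpoly_sum_single[of m] by (simp add: mvar_power prod)
qed

lemma mpoly_eval_mvar: "mpoly_eval mconst mvar p = p"
  using mpoly_sum_single[of p] by (simp add: mpoly_eval_def mon_eval_mvar mult_single)

lemma comm_ring_hom_mconst: "comm_ring_hom (mconst :: 'a::comm_ring_1 \<Rightarrow> ('v, 'a) mpoly)"
  by unfold_locales (auto simp: single_add mult_single)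

lemma comm_ring_hom_const_poly: "comm_ring_hom (\<lambda>a::'a::comm_ring_1. [:a:])"
  by unfold_locales (auto simp: one_pCons)

lemma comm_ring_hom_compose:
  "comm_ring_hom f \<Longrightarrow> comm_ring_hom g \<Longrightarrow> comm_ring_hom (\<lambda>x. g (f x))"
proof -
  assume "comm_ring_hom f" "comm_ring_hom g"
  then interpret f: comm_ring_hom f + g: comm_ring_hom g by auto
  show ?thesis by unfold_locales (auto simp: hom_distribs)
qed

subsection \<open>Weighted degrees\<close>

text \<open>Weights 1 give the total degree. Weights 0 on a set of indeterminates and 1 elsewhere
  give a degree that vanishes exactly on the polynomials in that set.\<close>

definition mon_wdeg :: "('v \<Rightarrow> nat) \<Rightarrow> 'v monom \<Rightarrow> nat" where
  "mon_wdeg W m = (\<Sum>v\<in>Poly_Mapping.keys m. W v * Poly_Mapping.lookup m v)"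

definition wdeg :: "('v \<Rightarrow> nat) \<Rightarrow> ('v, 'a::zero) mpoly \<Rightarrow> nat" where
  "wdeg W p = Max (insert 0 (mon_wdeg W ` Poly_Mapping.keys p))"

lemma mdeg_eq_wdeg: "mdeg = wdeg (\<lambda>_. 1)"
  by (simp add: fun_eq_iff mdeg_def wdeg_def mon_deg_def mon_wdeg_def[abs_def])

lemma wdeg_le_iff: "wdeg W p \<le> n \<longleftrightarrow> (\<forall>m\<in>Poly_Mapping.keys p. mon_wdeg W m \<le> n)"
  unfolding wdeg_def by (subst Max_le_iff) auto

lemma wdeg_eq_0_iff: "wdeg W p = 0 \<longleftrightarrow> in_vars {v. W v = 0} p"
  using wdeg_le_iff[of W p 0] by (auto simp: in_vars_def mon_wdeg_def in_keys_iff)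

text \<open>The substitution \<open>Z\<^sub>v \<mapsto> Z\<^sub>v \<tau>\<^bsup>W v\<^esup>\<close> turns the weighted degree into the degree in \<open>\<tau>\<close>.\<close>

definition grading :: "('v \<Rightarrow> nat) \<Rightarrow> ('v, 'a::comm_ring_1) mpoly \<Rightarrow> ('v, 'a) mpoly poly" where
  "grading W = mpoly_eval (\<lambda>c. [:mconst c:]) (\<lambda>v. Polynomial.monom (mvar v) (W v))"

text \<open>The coefficient of \<tau>^k is the part of weighted degree \<open>k\<close>; injectivity
  of \<open>grading\<close> and its degree both follow from this.\<close>

lemma lookup_coeff_grading:
  "Poly_Mapping.lookup (coeff (grading W p) k) m = (if mon_wdeg W m = k then Poly_Mapping.lookup p m else 0)"
proof -
  have prod: "(\<Prod>v\<in>V. Polynomial.monom (a v) (n v)) = Polynomial.monom (prod a V) (sum n V)"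
    for V :: "'v set" and a :: "'v \<Rightarrow> ('v, 'a) mpoly" and n
    by (induction V rule: infinite_finite_induct) (auto simp: mult_monom)
  have mon: "mon_eval (\<lambda>v. Polynomial.monom (mvar v) (W v)) m =
      Polynomial.monom (Poly_Mapping.single m (1::'a)) (mon_wdeg W m)" for m
    unfolding mon_eval_mvar[symmetric]
    by (simp add: mon_eval_def monom_power prod mon_wdeg_def)
  have "coeff (grading W p) k =
      (\<Sum>m\<in>Poly_Mapping.keys p. if mon_wdeg W m = k then Poly_Mapping.single m (Poly_Mapping.lookup p m) else 0)"
    unfolding grading_def mpoly_eval_def mon
    by (simp add: coeff_sum smult_monom mult_single coeff_monom)
  then have "Poly_Mapping.lookup (coeff (grading W p) k) m =
      (\<Sum>m'\<in>Poly_Mapping.keys p. if m' = m then if mon_wdeg W m = k then Poly_Mapping.lookup p m else 0 else 0)"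
    by (simp only: lookup_sum) (rule sum.cong, auto simp: lookup_single when_def)
  then show ?thesis by (simp add: in_keys_iff)
qed

lemma inj_comm_ring_hom_grading: "inj_comm_ring_hom (grading W :: (nat, 'a::comm_ring_1) mpoly \<Rightarrow> _)"
proof -
  interpret comm_ring_hom "grading W :: (nat, 'a) mpoly \<Rightarrow> _"
    unfolding grading_def
    by (intro comm_ring_hom_mpoly_eval comm_ring_hom_compose[OF comm_ring_hom_mconst comm_ring_hom_const_poly])
  show ?thesis
  proof (unfold_locales)
    show "p = 0" if eq: "grading W p = 0" for p :: "(nat, 'a) mpoly"
    proof (rule poly_mapping_eqI)
      show "Poly_Mapping.lookup p m = Poly_Mapping.lookup 0 m" for m
        using lookup_coeff_grading[of W p "mon_wdeg W m" m] eq by simp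
    qed
  qed
qed

lemma degree_grading: "degree (grading W p) = wdeg W p"
proof (rule antisym)
  show "degree (grading W p) \<le> wdeg W p"
  proof (rule degree_le, intro allI impI poly_mapping_eqI)
    fix k m assume "wdeg W p < k"
    then show "Poly_Mapping.lookup (coeff (grading W p) k) m = Poly_Mapping.lookup 0 m"
      using wdeg_le_iff[of W p "wdeg W p"] by (force simp: lookup_coeff_grading in_keys_iff)
  qed
  show "wdeg W p \<le> degree (grading W p)"
    unfolding wdeg_le_iff
  proof
    fix m assume "m \<in> Poly_Mapping.keys p"
    then have "Poly_Mapping.lookup (coeff (grading W p) (mon_wdeg W m)) m \<noteq> 0"
      by (simp add: lookup_coeff_grading in_keys_iff)
    then show "mon_wdeg W m \<le> degree (grading W p)" by (intro le_degree) auto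
  qed
qed

text \<open>Additivity on products is pulled back from the univariate degree along the injective
  \<open>grading\<close>.\<close>

lemma degfun_wdeg: "degfun (wdeg W :: (nat, 'a::idom) mpoly \<Rightarrow> nat)"
  using degfun_comp[OF degfun_degree inj_comm_ring_hom_grading, of W] unfolding degree_grading .

lemmas degfun_mdeg = degfun_wdeg[of "\<lambda>_. 1", folded mdeg_eq_wdeg]

text \<open>Applied to a form, which has degree at most d^2 - 1: its value has at most d^2 - 1 times
  the degree of the arguments, whether measured in Z or in U and V.\<close>

lemma degfun_mpoly_eval_le:
  assumes \<delta>: "degfun \<delta>" and h: "\<And>c. \<delta> (h c) = 0"
    and x: "\<And>m v. m \<in> Poly_Mapping.keys p \<Longrightarrow> v \<in> Poly_Mapping.keys m \<Longrightarrow> \<delta> (x v) \<le> b"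
  shows "\<delta> (mpoly_eval h x p) \<le> mdeg p * b"
  unfolding mpoly_eval_def
proof (rule degfun_sum_le[OF \<delta>])
  fix m assume m: "m \<in> Poly_Mapping.keys p"
  have "\<delta> (h (Poly_Mapping.lookup p m) * mon_eval x m) \<le> \<delta> (mon_eval x m)"
    using degfun_mult_le[OF \<delta>] h by (metis plus_nat.add_0)
  also have "\<dots> \<le> (\<Sum>v\<in>Poly_Mapping.keys m. \<delta> (x v ^ Poly_Mapping.lookup m v))"
    unfolding mon_eval_def by (rule degfun_prod_le[OF \<delta>])
  also have "\<dots> \<le> (\<Sum>v\<in>Poly_Mapping.keys m. Poly_Mapping.lookup m v * b)"
  proof (rule sum_mono)
    fix v assume "v \<in> Poly_Mapping.keys m"
    then have "Poly_Mapping.lookup m v * \<delta> (x v) \<le> Poly_Mapping.lookup m v * b"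
      using x[OF m] by simp
    then show "\<delta> (x v ^ Poly_Mapping.lookup m v) \<le> Poly_Mapping.lookup m v * b"
      using degfun_power_le[OF \<delta>, of "x v" "Poly_Mapping.lookup m v"] by linarith
  qed
  also have "\<dots> = mon_deg m * b" by (simp add: mon_deg_def sum_distrib_right)
  also have "\<dots> \<le> mdeg p * b"
    unfolding mdeg_def using m by (intro mult_right_mono Max_ge) auto
  finally show "\<delta> (h (Poly_Mapping.lookup p m) * mon_eval x m) \<le> mdeg p * b" .
qed

lemma wdeg_mconst: "wdeg W (mconst c) = 0"
  using wdeg_le_iff[of W "mconst c" 0] by (auto simp: mon_wdeg_def)

lemma mdeg_0_imp_mconst:
  assumes "mdeg p = 0"
  shows "p = mconst (Poly_Mapping.lookup p 0)"
proof (rule poly_mapping_eqI)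
  fix m
  have "m = 0" if "m \<in> Poly_Mapping.keys p"
    using assms that wdeg_eq_0_iff[of "\<lambda>_. 1" p]
    unfolding mdeg_eq_wdeg in_vars_def by simp
  then show "Poly_Mapping.lookup p m = Poly_Mapping.lookup (mconst (Poly_Mapping.lookup p 0)) m"
    by (auto simp: lookup_single when_def in_keys_iff)
qed

lemma mconst_unit: "(c::'k::field) \<noteq> 0 \<Longrightarrow> mconst c dvd (1 :: (nat, 'k) mpoly)"
  by (rule dvdI[of _ _ "mconst (inverse c)"]) (simp add: mult_single)

lemma additive_length_mdeg: "additive_length (mdeg :: (nat, 'k::field) mpoly \<Rightarrow> nat)"
  unfolding additive_length_def
proof (intro conjI allI impI)
  fix p :: "(nat, 'k) mpoly" assume p: "p \<noteq> 0" "mdeg p = 0"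
  then have "p = mconst (Poly_Mapping.lookup p 0)" using mdeg_0_imp_mconst by blast
  moreover from this p have "Poly_Mapping.lookup p 0 \<noteq> 0" by auto
  ultimately show "p dvd 1" using mconst_unit by metis
qed (use degfun_mult[OF degfun_mdeg] in blast)

subsection \<open>Multivariate polynomials over a field have unique factorization\<close>

text \<open>These weights express membership in the polynomial ring in the first \<open>m\<close>
  indeterminates as degree zero, which is the form that \<open>factorial_on\<close> takes.\<close>

definition later_vars :: "nat \<Rightarrow> nat \<Rightarrow> nat" where
  "later_vars m v = (if v < m then 0 else 1)"

lemma wdeg_later_vars_eq_0_iff: "wdeg (later_vars m) p = 0 \<longleftrightarrow> in_vars {..<m} p"
proof -
  have "{v. later_vars m v = 0} = {..<m}" by (auto simp: later_vars_def)
  then show ?thesis by (simp add: wdeg_eq_0_iff)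
qed

text \<open>The isomorphism that singles out indeterminate \<open>m\<close>, with the coefficients
  kept in the same type. Evaluation at \<open>mvar m\<close> always undoes it; the converse holds
  for polynomials whose coefficients involve only indeterminates below \<open>m\<close>.\<close>

definition split_var :: "nat \<Rightarrow> (nat, 'a::comm_ring_1) mpoly \<Rightarrow> (nat, 'a) mpoly poly" where
  "split_var m = mpoly_eval (\<lambda>c. [:mconst c:]) (\<lambda>v. if v = m then [:0, 1:] else [:mvar v:])"

lemma comm_ring_hom_split_var: "comm_ring_hom (split_var m)"
  unfolding split_var_def
  by (intro comm_ring_hom_mpoly_eval comm_ring_hom_compose[OF comm_ring_hom_mconst comm_ring_hom_const_poly])

lemma poly_split_var: "poly (split_var m p) (mvar m) = p"
proof -
  have "comm_ring_hom (\<lambda>F. poly F (mvar m :: (nat, 'a) mpoly))" by unfold_locales auto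
  from hom_mpoly_eval[OF this, of "\<lambda>c. [:mconst c:]" "\<lambda>v. if v = m then [:0, 1:] else [:mvar v:]" p]
  have "poly (split_var m p) (mvar m) = mpoly_eval mconst (\<lambda>v. poly (if v = m then [:0, 1:] else [:mvar v:]) (mvar m)) p"
    unfolding split_var_def by simp
  also have "\<dots> = mpoly_eval mconst mvar p" by (rule mpoly_eval_cong) auto
  finally show ?thesis by (simp add: mpoly_eval_mvar)
qed

lemma split_var_const:
  assumes "in_vars {..<m} p"
  shows "split_var m p = [:p:]"
proof -
  have "split_var m p = mpoly_eval (\<lambda>c. [:mconst c:]) (\<lambda>v. [:mvar v:]) p"
    unfolding split_var_def using assms by (intro mpoly_eval_cong) (auto simp: in_vars_def)
  also have "\<dots> = [:mpoly_eval mconst mvar p:]" by (rule hom_mpoly_eval[OF comm_ring_hom_const_poly, symmetric])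
  finally show ?thesis by (simp add: mpoly_eval_mvar)
qed

lemma split_var_mvar: "split_var m (mvar m) = [:0, 1:]"
  unfolding split_var_def mvar_def[of m] mpoly_eval_def
  by (simp add: mon_eval_single[unfolded One_nat_def] one_pCons[symmetric])

lemma split_var_poly:
  assumes "\<And>i. in_vars {..<m} (coeff F i)"
  shows "split_var m (poly F (mvar m)) = F"
proof -
  interpret comm_ring_hom "split_var m :: (nat, 'a::comm_ring_1) mpoly \<Rightarrow> _" by (rule comm_ring_hom_split_var)
  have "map_poly (split_var m) F = map_poly (\<lambda>a. [:a:]) F"
    by (rule poly_eqI) (simp add: coeff_map_poly split_var_const assms)
  then have "split_var m (poly F (mvar m)) = poly (map_poly (\<lambda>a. [:a:]) F) [:0, 1:]"
    by (simp flip: poly_map_poly add: split_var_mvar)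
  also have "\<dots> = pcompose F [:0, 1:]" by (simp add: pcompose_altdef)
  finally show ?thesis by (simp add: pcompose_idR)
qed

lemma split_var_on:
  fixes p :: "(nat, 'a::idom) mpoly"
  assumes "in_vars {..<Suc m} p"
  shows "poly_degfun 0 (wdeg (later_vars m)) (split_var m p) = 0"
proof -
  note d = degfun_wdeg[of "later_vars m", where 'a = 'a]
  have "poly_degfun 0 (wdeg (later_vars m)) (split_var m p) \<le> mdeg p * 0"
    unfolding split_var_def
  proof (rule degfun_mpoly_eval_le[OF degfun_poly_degfun[OF d]])
    show "poly_degfun 0 (wdeg (later_vars m)) [:mconst c:] = 0" for c :: 'a
      by (simp add: poly_degfun_const[OF d] wdeg_mconst)
    fix mo v assume mv: "mo \<in> Poly_Mapping.keys p" "v \<in> Poly_Mapping.keys mo"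
    then have "v < Suc m" using assms by (auto simp: in_vars_def)
    moreover have "wdeg (later_vars m) (mvar v :: (nat, 'a) mpoly) = 0" if "v < m" for v
      using that by (auto simp: wdeg_later_vars_eq_0_iff in_vars_def mvar_def)
    moreover have "poly_degfun 0 (wdeg (later_vars m)) [:0, 1 :: (nat, 'a) mpoly:] = 0"
      using poly_degfun_monom[OF d, of 1 1] degfun_1[OF d] by (simp add: monom_altdef)
    ultimately show "poly_degfun 0 (wdeg (later_vars m)) (if v = m then [:0, 1:] else [:mvar v :: (nat, 'a) mpoly:]) \<le> 0"
      by (auto simp: poly_degfun_const[OF d] less_Suc_eq)
  qed
  then show ?thesis by simp
qed

text \<open>In the induction step \<open>split_var m\<close> moves the divisibility into polynomials
  in one variable, where \<open>factorial_on_poly\<close> applies to the hypothesis for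
  \<open>m\<close>; evaluation at \<open>mvar m\<close> moves the result back.\<close>

lemma factorial_on_wdeg: "factorial_on (wdeg (later_vars m) :: (nat, 'k::field) mpoly \<Rightarrow> nat)"
proof (induction m)
  case 0
  have *: "wdeg (later_vars 0) = (mdeg :: (nat, 'k) mpoly \<Rightarrow> nat)"
    unfolding mdeg_eq_wdeg by (simp add: later_vars_def[abs_def])
  show ?case
    unfolding *
  proof (rule factorial_onI[OF degfun_mdeg additive_length_mdeg])
    \<comment> \<open>An irreducible \<open>p\<close> of degree 0 would be a nonzero constant, hence
      a unit.\<close>
    fix p a b :: "(nat, 'k) mpoly" assume "mdeg p = 0" "irreducible p"
    then show "p dvd a \<or> p dvd b"
      using additive_length_unit_iff[OF additive_length_mdeg, of p] by (simp add: irreducible_def)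
  qed
next
  case (Suc m)
  note d = degfun_wdeg[of "later_vars m", where 'a = 'k]
  note \<Delta> = degfun_poly_degfun[OF d, of 0]
  interpret \<Xi>: comm_ring_hom "split_var m :: (nat, 'k) mpoly \<Rightarrow> _" by (rule comm_ring_hom_split_var)
  have on_iff: "poly_degfun 0 (wdeg (later_vars m)) F = 0 \<longleftrightarrow> (\<forall>i. in_vars {..<m} (coeff F i))"
    for F :: "(nat, 'k) mpoly poly"
    using poly_degfun_0_le_iff[OF d, of F 0] by (simp add: wdeg_later_vars_eq_0_iff)
  show ?case
  proof (rule factorial_onI[OF degfun_wdeg additive_length_mdeg], unfold wdeg_later_vars_eq_0_iff)
    fix p a b :: "(nat, 'k) mpoly"
    assume on: "in_vars {..<Suc m} p" "in_vars {..<Suc m} a" "in_vars {..<Suc m} b"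
      and irr: "irreducible p" and dvd: "p dvd a * b"
    have p0: "split_var m p \<noteq> 0" using irr poly_split_var[of m p] by (auto simp: irreducible_def)
    have "irreducible (split_var m p)"
      unfolding irreducible_def
    proof (intro conjI allI impI p0)
      show "\<not> split_var m p dvd 1"
      proof
        assume "split_var m p dvd 1"
        then obtain G where "1 = split_var m p * G" by (auto elim: dvdE)
        then have "1 = poly (split_var m p) (mvar m) * poly G (mvar m)" by (metis poly_1 poly_mult)
        then show False using irr unfolding poly_split_var irreducible_def by (metis dvd_triv_left)
      qed
      \<comment> \<open>Factors of \<open>split_var m p\<close> have their coefficients in the
        smaller ring, so \<open>split_var m\<close> undoes their evaluation at \<open>mvar m\<close>
        and carries units back to units.\<close>
      fix G H assume GH: "split_var m p = G * H"
      then have on': "poly_degfun 0 (wdeg (later_vars m)) G = 0" "poly_degfun 0 (wdeg (later_vars m)) H = 0"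
        using degfun_zero_factor[OF \<Delta>, of G H] split_var_on[OF on(1)] p0 by auto
      have unit: "F dvd 1" if "poly F (mvar m) dvd 1" "poly_degfun 0 (wdeg (later_vars m)) F = 0"
        for F :: "(nat, 'k) mpoly poly"
      proof -
        have "split_var m (poly F (mvar m)) dvd split_var m 1" using that(1) by (rule \<Xi>.hom_dvd)
        then show ?thesis using split_var_poly[of m F] that(2) on_iff[of F] by simp
      qed
      have "p = poly G (mvar m) * poly H (mvar m)" using GH poly_split_var[of m p] by simp
      then show "G dvd 1 \<or> H dvd 1" using irr unit on' unfolding irreducible_def by blast
    qed
    moreover have "split_var m p dvd split_var m a * split_var m b"
      using \<Xi>.hom_dvd[OF dvd] by (simp add: \<Xi>.hom_mult)
    ultimately have "split_var m p dvd split_var m a \<or> split_var m p dvd split_var m b"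
      by (rule factorial_onD(3)[OF factorial_on_poly[OF Suc]]) (intro split_var_on on)+
    moreover have "x dvd y" if xy: "split_var m x dvd split_var m y" for x y :: "(nat, 'k) mpoly"
    proof -
      obtain G where "split_var m y = split_var m x * G" using xy by (rule dvdE)
      then have "poly (split_var m y) (mvar m) = poly (split_var m x) (mvar m) * poly G (mvar m)" by simp
      then show ?thesis by (simp add: poly_split_var)
    qed
    ultimately show "p dvd a \<or> p dvd b" by blast
  qed
qed

lemma in_vars_lessThan_exists: "\<exists>m. in_vars {..<m} (p :: (nat, 'a::zero) mpoly)"
proof -
  have "finite (\<Union>m\<in>Poly_Mapping.keys p. Poly_Mapping.keys m)" by auto
  then have "\<exists>m. (\<Union>m\<in>Poly_Mapping.keys p. Poly_Mapping.keys m) \<subseteq> {..<m}"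
    by (simp only: finite_nat_iff_bounded)
  then show ?thesis unfolding in_vars_def UN_subset_iff .
qed

lemma in_vars_mono: "in_vars V p \<Longrightarrow> V \<subseteq> V' \<Longrightarrow> in_vars V' p"
  unfolding in_vars_def by fast

text \<open>The zero function restricts nothing, so this is unique factorization in the whole
  type.\<close>

abbreviation factorial_type :: "'a::idom itself \<Rightarrow> bool" where
  "factorial_type (_ :: 'a itself) \<equiv> factorial_on (\<lambda>_::'a. 0)"

text \<open>The three polynomials involved lie in finitely many indeterminates, where
  \<open>factorial_on_wdeg\<close> applies.\<close>

lemma factorial_mpoly: "factorial_type TYPE((nat, 'k::field) mpoly)"
proof (rule factorial_onI[OF degfun_const_0 additive_length_mdeg])
  fix p a b :: "(nat, 'k) mpoly"
  assume irr: "irreducible p" "p dvd a * b"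
  obtain m1 where m1: "in_vars {..<m1} p" using in_vars_lessThan_exists by blast
  obtain m2 where m2: "in_vars {..<m2} a" using in_vars_lessThan_exists by blast
  obtain m3 where m3: "in_vars {..<m3} b" using in_vars_lessThan_exists by blast
  have "in_vars {..<m1 + m2 + m3} p" "in_vars {..<m1 + m2 + m3} a" "in_vars {..<m1 + m2 + m3} b"
    by (rule in_vars_mono[OF m1], force, rule in_vars_mono[OF m2], force, rule in_vars_mono[OF m3], force)
  then show "p dvd a \<or> p dvd b"
    by (intro factorial_onD(3)[OF factorial_on_wdeg[of "m1 + m2 + m3"] irr])
      (simp_all only: wdeg_later_vars_eq_0_iff)
qed

lemma factorial_field: "factorial_type TYPE('k::field)"
  unfolding factorial_on_def
proof (intro conjI)
  have "additive_length (\<lambda>_::'k. 0)" by (auto simp: additive_length_def dvd_field_iff)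
  then show "\<exists>l::'k \<Rightarrow> nat. additive_length l" by blast
qed (auto simp: degfun_const_0 irreducible_def dvd_field_iff)

lemma factorial_poly: "factorial_type TYPE('a::idom) \<Longrightarrow> factorial_type TYPE('a poly)"
proof -
  assume "factorial_type TYPE('a)"
  then have "factorial_on (poly_degfun 0 (\<lambda>_::'a. 0))" by (rule factorial_on_poly)
  moreover have "poly_degfun 0 (\<lambda>_::'a. 0) = (\<lambda>_. 0)"
    using poly_degfun_le_iff[of 0 "\<lambda>_::'a. 0" _ 0] by (simp add: fun_eq_iff)
  ultimately show ?thesis by simp
qed

section \<open>Greatest common divisors and the spectral polynomial\<close>

text \<open>Taking \<open>c = 0\<close> shows that such a family has a nonzero member; this is used
  repeatedly below.\<close>

definition coprime_family :: "'t set \<Rightarrow> ('t \<Rightarrow> 'a::comm_semiring_1) \<Rightarrow> bool" where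
  "coprime_family T b \<longleftrightarrow> (\<forall>c. (\<forall>t\<in>T. c dvd b t) \<longrightarrow> c dvd 1)"

text \<open>Each irreducible factor of \<open>e\<close> misses some \<open>b t\<close>, so by
  primality it divides \<open>s\<close>; the factors are cancelled one after the other.\<close>

lemma coprime_family_dvd_cancel:
  fixes b :: "'t \<Rightarrow> 'a::idom"
  assumes fac: "factorial_type TYPE('a)" and cop: "coprime_family T b"
    and dvd: "\<And>t. t \<in> T \<Longrightarrow> e dvd s * b t"
  shows "e dvd s"
proof (cases "e = 0")
  case True
  have "s = 0"
  proof (rule ccontr)
    assume "s \<noteq> 0"
    then have "\<forall>t\<in>T. 0 dvd b t" using dvd True by fastforce
    then have "0 dvd (1::'a)" using cop unfolding coprime_family_def by blast
    then show False by simp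
  qed
  then show ?thesis by simp
next
  case False
  from factorial_onD(2)[OF fac] False dvd show ?thesis
  proof (induction e arbitrary: s rule: irreducible_induct)
    case (unit u)
    show ?case by (rule dvd_trans[OF unit(1) one_dvd])
  next
    case (irreducible p a)
    have p: "p \<noteq> 0" "\<not> p dvd 1" using irreducible.hyps(1) by (auto simp: irreducible_def)
    then obtain t where t: "t \<in> T" "\<not> p dvd b t" using cop unfolding coprime_family_def by blast
    have "p dvd s * b t" using irreducible.prems[OF t(1)] by (rule dvd_mult_left)
    then have "p dvd s" using factorial_onD(3)[OF fac irreducible.hyps(1)] t(2) by blast
    then obtain s' where s': "s = p * s'" by (rule dvdE)
    have "a dvd s' * b t" if "t \<in> T" for t
      using irreducible.prems[OF that] p(1) unfolding s' by (simp add: mult.assoc)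
    then have "a dvd s'" by (rule irreducible.IH)
    then show ?case unfolding s' by (rule mult_dvd_mono[OF dvd_refl])
  qed
qed

text \<open>Common irreducible factors are pulled out as long as there are any; the length of
  \<open>b t0\<close> bounds their number.\<close>

lemma gcd_decomposition:
  fixes b :: "'t \<Rightarrow> 'a::idom"
  assumes fac: "factorial_type TYPE('a)" and t0: "t0 \<in> T"
  shows "b t0 \<noteq> 0 \<Longrightarrow> \<exists>D w. D \<noteq> 0 \<and> (\<forall>t\<in>T. b t = D * w t) \<and> coprime_family T w"
proof -
  obtain l :: "'a \<Rightarrow> nat" where l: "additive_length l" using factorial_onD(2)[OF fac] by blast
  show "b t0 \<noteq> 0 \<Longrightarrow> ?thesis"
  proof (induction "l (b t0)" arbitrary: b rule: less_induct)
    case less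
    show ?case
    proof (cases "coprime_family T b")
      case True
      then show ?thesis by (intro exI[of _ 1] exI[of _ b]) auto
    next
      case False
      then obtain c where c: "\<forall>t\<in>T. c dvd b t" "\<not> c dvd 1" unfolding coprime_family_def by blast
      then have "c \<noteq> 0" using t0 less.prems by force
      then obtain p where p: "irreducible p" "p dvd c" using irreducible_dvd_exists[OF l] c(2) by blast
      then have "\<forall>t\<in>T. \<exists>x. b t = p * x" using c(1) by (meson dvd_trans dvdE)
      then obtain b' where b': "\<forall>t\<in>T. b t = p * b' t" by metis
      have nz: "p \<noteq> 0" "b' t0 \<noteq> 0" using b' t0 less.prems by auto
      have "l p \<noteq> 0" using p(1) nz additive_length_unit_iff[OF l] unfolding irreducible_def by blast
      moreover have "l (b t0) = l p + l (b' t0)" using b' t0 nz l unfolding additive_length_def by metis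
      ultimately obtain D w where "D \<noteq> 0" "\<forall>t\<in>T. b' t = D * w t" "coprime_family T w"
        using less.hyps[of b'] nz by auto
      then show ?thesis using b' nz by (intro exI[of _ "p * D"] exI[of _ w]) auto
    qed
  qed
qed

lemma is_gcd_of_decomposition:
  fixes b :: "'t \<Rightarrow> 'a::idom"
  assumes "factorial_type TYPE('a)" "coprime_family T w" "\<And>t. t \<in> T \<Longrightarrow> b t = D * w t"
  shows "is_gcd (b ` T) D"
  unfolding is_gcd_def
proof (intro conjI allI impI)
  show "\<forall>p\<in>b ` T. D dvd p" using assms(3) by simp
  fix e assume e: "\<forall>p\<in>b ` T. e dvd p"
  show "e dvd D"
  proof (rule coprime_family_dvd_cancel[OF assms(1,2)])
    show "e dvd D * w t" if "t \<in> T" for t using e that assms(3)[OF that] by fastforce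
  qed
qed

lemma is_gcd_exists:
  fixes b :: "'t \<Rightarrow> 'a::idom"
  assumes "factorial_type TYPE('a)"
  shows "\<exists>D. is_gcd (b ` T) D"
proof (cases "\<exists>t\<in>T. b t \<noteq> 0")
  case True
  then obtain t0 where "t0 \<in> T" "b t0 \<noteq> 0" by blast
  then obtain D w where "\<forall>t\<in>T. b t = D * w t" "coprime_family T w"
    using gcd_decomposition[OF assms, of t0 T b] by blast
  then have "is_gcd (b ` T) D" by (intro is_gcd_of_decomposition[OF assms]) auto
  then show ?thesis by blast
next
  case False
  then have "is_gcd (b ` T) 0" by (auto simp: is_gcd_def)
  then show ?thesis by blast
qed

lemma is_gcd_associated:
  fixes D :: "'a::idom"
  assumes "is_gcd A D" "is_gcd A E"
  obtains u where "u dvd 1" "E = u * D"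
proof -
  have dvd: "D dvd E" "E dvd D" using assms unfolding is_gcd_def by blast+
  obtain u where u: "E = D * u" using dvd(1) by (rule dvdE)
  obtain v where v: "D = E * v" using dvd(2) by (rule dvdE)
  show thesis
  proof (cases "D = 0")
    case True
    then show thesis using u by (intro that[of 1]) auto
  next
    case False
    have "D * 1 = D * (u * v)" using v unfolding u by (simp add: mult.assoc)
    then have "1 = u * v" using False by (metis mult_cancel_left)
    then have "u dvd 1" by (rule dvdI)
    then show thesis using u by (intro that[of u]) (auto simp: mult.commute)
  qed
qed

section \<open>Units of A[U,V] and the normalized GCD\<close>

lemma unit_poly_poly:
  fixes u :: "'a::idom poly poly"
  assumes "u dvd 1"
  obtains a where "u = [:[:a:]:]" "a dvd 1"
proof -
  from assms obtain p where "u = [:p:]" "p dvd 1" by (auto simp: is_unit_poly_iff)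
  moreover from this(2) obtain a where "p = [:a:]" "a dvd 1" by (auto simp: is_unit_poly_iff)
  ultimately show thesis using that by blast
qed

context
  fixes lc :: "'a::idom \<Rightarrow> 'k::field" and \<iota> :: "'k \<Rightarrow> 'a"
  assumes fac: "factorial_type TYPE('a poly poly)"
    and unit: "\<And>a. a dvd 1 \<longleftrightarrow> (\<exists>c. c \<noteq> 0 \<and> a = \<iota> c)"
    and lc_mult: "\<And>c a. lc (\<iota> c * a) = c * lc a"
    and lc_0: "\<And>a. lc a = 0 \<longleftrightarrow> a = 0"
begin

lemma lc_const_mult: "lc (lead_coeff (lead_coeff ([:[:\<iota> c:]:] * D))) = c * lc (lead_coeff (lead_coeff D))"
  by (simp add: lead_coeff_mult lc_mult del: mult_pCons_left)

text \<open>The definite description in \<open>spect\<close> denotes: units of A[U,V] are the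
  nonzero scalars, and multiplying by one scales the leading coefficient, so exactly one associate
  of a nonzero GCD is normalized. With \<open>\<iota>\<close> the identity this covers A = K, with
  \<open>mconst\<close> it covers A = K[Z].\<close>

lemma spect_is_gcd: "is_gcd ((\<lambda>t. ev_int (pencil_coeff f g) (\<Phi> t)) ` T) (spect lc T \<Phi> f g)"
proof -
  let ?X = "(\<lambda>t. ev_int (pencil_coeff f g) (\<Phi> t)) ` T"
  let ?L = "\<lambda>D. lc (lead_coeff (lead_coeff D))"
  obtain D0 where D0: "is_gcd ?X D0" using is_gcd_exists[OF fac] by blast
  have "\<exists>D. is_gcd ?X D \<and> (D = 0 \<or> ?L D = 1)"
  proof (cases "D0 = 0")
    case False
    then have L: "?L D0 \<noteq> 0" by (simp add: lc_0)
    define u where "u = [:[:\<iota> (inverse (?L D0)):]:]"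
    have "\<iota> (inverse (?L D0)) dvd 1" using unit L by (metis inverse_nonzero_iff_nonzero)
    then have "u dvd 1" by (simp add: u_def is_unit_const_poly_iff)
    then have "is_gcd ?X (u * D0)"
      using D0 unfolding is_gcd_def by (simp add: mult_unit_dvd_iff' dvd_mult)
    moreover have "?L (u * D0) = 1" unfolding u_def lc_const_mult using L by simp
    ultimately show ?thesis by blast
  qed (use D0 in blast)
  moreover have "D = E" if D: "is_gcd ?X D \<and> (D = 0 \<or> ?L D = 1)" and E: "is_gcd ?X E \<and> (E = 0 \<or> ?L E = 1)" for D E
  proof -
    obtain u where u: "u dvd 1" "E = u * D" using is_gcd_associated D E by metis
    then obtain a where a: "u = [:[:a:]:]" "a dvd 1" using unit_poly_poly by blast
    then obtain c where c: "c \<noteq> 0" "a = \<iota> c" using unit by blast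
    show ?thesis
    proof (cases "D = 0")
      case False
      then have "E \<noteq> 0" using u by force
      then have "?L D = 1" "?L E = 1" using False D E by auto
      moreover have "?L E = c * ?L D" unfolding u(2) a(1) c(2) by (rule lc_const_mult)
      ultimately have "c = 1" by simp
      \<comment> \<open>By \<open>unit\<close>, 1 is some \<open>\<iota> c1\<close>; comparing
        leading coefficients through \<open>lc_mult\<close> gives \<open>c1 = 1\<close>.\<close>
      moreover have "\<iota> 1 = 1"
      proof -
        obtain c1 where c1: "c1 \<noteq> 0" "1 = \<iota> c1" using unit[of 1] by auto
        have "lc (\<iota> c1 * 1) = c1 * lc 1" by (rule lc_mult)
        then have "c1 = 1" using c1 lc_0[of 1] by simp
        then show ?thesis using c1 by simp
      qed
      ultimately show ?thesis using u a c by (simp add: one_pCons[symmetric])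
    qed (use u in simp)
  qed
  ultimately have "\<exists>!D. is_gcd ?X D \<and> (D = 0 \<or> ?L D = 1)" by blast
  from theI'[OF this] show ?thesis unfolding spect_def by blast
qed

end

lemma unit_mpoly_iff: "(a :: (nat, 'k::field) mpoly) dvd 1 \<longleftrightarrow> (\<exists>c. c \<noteq> 0 \<and> a = mconst c)"
proof
  assume "a dvd 1"
  then have "a \<noteq> 0" by force
  then have "mdeg a = 0" using additive_length_unit_iff[OF additive_length_mdeg] \<open>a dvd 1\<close> by blast
  then have "a = mconst (Poly_Mapping.lookup a 0)" by (rule mdeg_0_imp_mconst)
  moreover from this \<open>a \<noteq> 0\<close> have "Poly_Mapping.lookup a 0 \<noteq> 0" by auto
  ultimately show "\<exists>c. c \<noteq> 0 \<and> a = mconst c" by blast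
qed (auto intro: mconst_unit)

lemma mlead_coeff_eq_0_iff: "mlead_coeff p = 0 \<longleftrightarrow> p = 0"
proof
  assume "mlead_coeff p = 0"
  then have "Max (Poly_Mapping.keys p) \<notin> Poly_Mapping.keys p" by (simp add: mlead_coeff_def in_keys_iff)
  then have "Poly_Mapping.keys p = {}" using Max_in finite_keys by blast
  then show "p = 0" by simp
qed (simp add: mlead_coeff_def)

lemma lookup_mconst_mult: "Poly_Mapping.lookup (mconst c * p) m = c * Poly_Mapping.lookup (p :: ('v, 'a::comm_ring_1) mpoly) m"
  by (simp flip: mult_map_scale_conv_mult add: Poly_Mapping.map.rep_eq when_def)

lemma mlead_coeff_mconst_mult: "mlead_coeff (mconst (c::'k::field) * p) = c * mlead_coeff p"
proof (cases "c = 0")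
  case False
  then have "Poly_Mapping.keys (mconst c * p) = Poly_Mapping.keys p"
    by (auto simp: in_keys_iff lookup_mconst_mult)
  then show ?thesis by (simp add: mlead_coeff_def lookup_mconst_mult)
qed (simp add: mlead_coeff_def)

lemma spect_mpoly_is_gcd:
  "is_gcd ((\<lambda>t. ev_int (pencil_coeff f g) (\<Phi> t)) ` T) (spect_mpoly T \<Phi> f g)"
  by (rule spect_is_gcd[where \<iota> = mconst])
    (auto intro: factorial_poly factorial_mpoly simp: unit_mpoly_iff mlead_coeff_eq_0_iff mlead_coeff_mconst_mult)

text \<open>The origin of \<open>\<kappa>\<close>: specialization yields some GCD, which need not be
  the normalized one.\<close>

lemma is_gcd_spect_field:
  fixes f g :: "(nat, 'k::field) mpoly"
  assumes "is_gcd ((\<lambda>t. ev_int (pencil_coeff f g) (\<Phi> t)) ` T) D"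
  shows "\<exists>\<kappa>. \<kappa> \<noteq> 0 \<and> D = smult [:\<kappa>:] (spect_field T \<Phi> f g)"
proof -
  have "is_gcd ((\<lambda>t. ev_int (pencil_coeff f g) (\<Phi> t)) ` T) (spect_field T \<Phi> f g)"
    by (rule spect_is_gcd[where \<iota> = "\<lambda>c. c"])
      (auto intro: factorial_poly factorial_field simp: dvd_field_iff)
  then obtain u where u: "u dvd 1" "D = u * spect_field T \<Phi> f g" using is_gcd_associated assms by blast
  then obtain a where a: "u = [:[:a:]:]" "a dvd 1" using unit_poly_poly by blast
  then have "a \<noteq> 0" by force
  then show ?thesis using u a by auto
qed

section \<open>Sylvester matrices\<close>

text \<open>Both polynomials are regarded as having formal degree \<open>e\<close>.\<close>

definition sylv :: "nat \<Rightarrow> 'a::comm_ring_1 poly \<Rightarrow> 'a poly \<Rightarrow> 'a mat" where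
  "sylv e x y = mat (2 * e) (2 * e) (\<lambda>(r, c).
     if c < e then coeff (Polynomial.monom 1 c * x) r else coeff (Polynomial.monom 1 (c - e) * y) r)"

lemma sylv_carrier: "sylv e x y \<in> carrier_mat (2 * e) (2 * e)"
  by (simp add: sylv_def)

text \<open>A vector of length \<open>2 * e\<close> is a pair of coefficient lists of length
  \<open>e\<close>, and kernel vectors of the matrix are syzygies of \<open>x\<close> and
  \<open>y\<close> with both multipliers of degree below \<open>e\<close>.\<close>

lemma sylv_mult_vec:
  assumes "r < 2 * e"
  shows "(sylv e x y *\<^sub>v vec (2 * e) (\<lambda>c. if c < e then u c else v (c - e))) $ r =
    coeff ((\<Sum>c<e. Polynomial.monom (u c) c) * x + (\<Sum>c<e. Polynomial.monom (v c) c) * y) r"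
proof -
  let ?m = "\<lambda>c. Polynomial.monom 1 c :: 'a poly"
  let ?f = "\<lambda>c. (if c < e then coeff (?m c * x) r else coeff (?m (c - e) * y) r) *
      (if c < e then u c else v (c - e))"
  have mon: "coeff (Polynomial.monom a c * z) r = a * coeff (?m c * z) r" for a :: 'a and c z
    by (simp add: coeff_monom_mult)
  have "(sylv e x y *\<^sub>v vec (2 * e) (\<lambda>c. if c < e then u c else v (c - e))) $ r = (\<Sum>c = 0..<2 * e. ?f c)"
    using assms by (simp add: sylv_def scalar_prod_def cong: if_cong)
  also have "\<dots> = (\<Sum>c = 0..<e. ?f c) + (\<Sum>c = e..<2 * e. ?f c)"
    by (rule sum.atLeastLessThan_concat[symmetric]) auto
  also have "(\<Sum>c = e..<2 * e. ?f c) = (\<Sum>c = 0..<e. ?f (c + e))"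
    using sum.shift_bounds_nat_ivl[of ?f 0 e e] by (simp add: mult_2)
  also have "\<dots> = (\<Sum>c<e. v c * coeff (?m c * y) r)"
    by (simp add: atLeast0LessThan mult.commute)
  also have "(\<Sum>c = 0..<e. ?f c) = (\<Sum>c<e. u c * coeff (?m c * x) r)"
    by (simp add: atLeast0LessThan mult.commute)
  also have "(\<Sum>c<e. u c * coeff (?m c * x) r) + (\<Sum>c<e. v c * coeff (?m c * y) r) =
      coeff ((\<Sum>c<e. Polynomial.monom (u c) c) * x + (\<Sum>c<e. Polynomial.monom (v c) c) * y) r"
    by (simp only: coeff_add sum_distrib_right coeff_sum mon[of "u _"] mon[of "v _"])
  finally show ?thesis .
qed

lemma sum_monom_coeff:
  assumes "\<And>i. e \<le> i \<Longrightarrow> coeff p i = 0"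
  shows "(\<Sum>c<e. Polynomial.monom (coeff p c) c) = p"
  using assms by (intro poly_eqI) (auto simp: coeff_sum coeff_monom not_less)

lemma det_sylv_eq_0I:
  fixes x y :: "'a::idom poly"
  assumes "\<alpha> \<noteq> 0 \<or> \<beta> \<noteq> 0" and \<alpha>: "\<And>i. e \<le> i \<Longrightarrow> coeff \<alpha> i = 0" and \<beta>: "\<And>i. e \<le> i \<Longrightarrow> coeff \<beta> i = 0"
    and "\<alpha> * x + \<beta> * y = 0"
  shows "det (sylv e x y) = 0"
proof -
  define v where "v = vec (2 * e) (\<lambda>c. if c < e then coeff \<alpha> c else coeff \<beta> (c - e))"
  have "v \<noteq> 0\<^sub>v (2 * e)"
  proof
    assume v0: "v = 0\<^sub>v (2 * e)"
    have "coeff \<alpha> i = 0" for i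
      using arg_cong[OF v0, of "\<lambda>v. v $ i"] \<alpha>[of i] by (cases "i < e") (auto simp: v_def)
    moreover have "coeff \<beta> i = 0" for i
      using arg_cong[OF v0, of "\<lambda>v. v $ (i + e)"] \<beta>[of i] by (cases "i < e") (auto simp: v_def)
    ultimately show False using assms(1) by (auto simp: poly_eq_iff)
  qed
  moreover have "sylv e x y *\<^sub>v v = 0\<^sub>v (2 * e)"
  proof (rule eq_vecI)
    fix r assume "r < dim_vec (0\<^sub>v (2 * e) :: 'a vec)"
    then have r: "r < 2 * e" by simp
    have "(\<Sum>c<e. Polynomial.monom (coeff \<alpha> c) c) = \<alpha>" "(\<Sum>c<e. Polynomial.monom (coeff \<beta> c) c) = \<beta>"
      by (rule sum_monom_coeff, rule \<alpha>, assumption, rule sum_monom_coeff, rule \<beta>, assumption)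
    then show "(sylv e x y *\<^sub>v v) $ r = 0\<^sub>v (2 * e) $ r"
      unfolding v_def sylv_mult_vec[OF r] using r assms(4) by simp
  qed (simp add: sylv_def)
  moreover have "v \<in> carrier_vec (2 * e)" by (simp add: v_def)
  ultimately show ?thesis using det_0_iff_vec_prod_zero[OF sylv_carrier] by blast
qed

lemma det_sylv_eq_0E:
  fixes x y :: "'a::idom poly"
  assumes "det (sylv e x y) = 0" and x: "degree x \<le> e" and y: "degree y \<le> e"
  obtains \<alpha> \<beta> where "\<alpha> \<noteq> 0 \<or> \<beta> \<noteq> 0" "\<And>i. e \<le> i \<Longrightarrow> coeff \<alpha> i = 0" "\<And>i. e \<le> i \<Longrightarrow> coeff \<beta> i = 0"
    "\<alpha> * x + \<beta> * y = 0"
proof -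
  obtain v where v: "v \<in> carrier_vec (2 * e)" "v \<noteq> 0\<^sub>v (2 * e)" "sylv e x y *\<^sub>v v = 0\<^sub>v (2 * e)"
    using det_0_iff_vec_prod_zero[OF sylv_carrier] assms(1) by blast
  define \<alpha> where "\<alpha> = (\<Sum>c<e. Polynomial.monom (v $ c) c)"
  define \<beta> where "\<beta> = (\<Sum>c<e. Polynomial.monom (v $ (c + e)) c)"
  have v_eq: "v = vec (2 * e) (\<lambda>c. if c < e then v $ c else v $ (c - e + e))"
    using v(1) by (intro eq_vecI) auto
  have co: "coeff \<alpha> i = (if i < e then v $ i else 0)" "coeff \<beta> i = (if i < e then v $ (i + e) else 0)" for i
    by (auto simp: \<alpha>_def \<beta>_def coeff_sum coeff_monom)
  have deg: "degree p \<le> e - 1" if "\<And>i. e \<le> i \<Longrightarrow> coeff p i = 0" for p :: "'a poly"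
    using that by (intro degree_le) auto
  show thesis
  proof (rule that)
    show "\<alpha> \<noteq> 0 \<or> \<beta> \<noteq> 0"
    proof (rule ccontr)
      assume "\<not> ?thesis"
      then have *: "coeff \<alpha> i = 0" "coeff \<beta> i = 0" for i by auto
      have "v $ i = 0" if "i < 2 * e" for i
        using *(1)[of i] *(2)[of "i - e"] that unfolding co by (auto split: if_splits)
      then show False using v(1,2) by (auto intro!: eq_vecI)
    qed
    show "coeff \<alpha> i = 0" "coeff \<beta> i = 0" if "e \<le> i" for i using that by (auto simp: co)
    show "\<alpha> * x + \<beta> * y = 0"
    proof (rule poly_eqI)
      fix r
      show "coeff (\<alpha> * x + \<beta> * y) r = coeff 0 r"
      proof (cases "r < 2 * e")
        case True
        have "(sylv e x y *\<^sub>v v) $ r = coeff (\<alpha> * x + \<beta> * y) r"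
          by (subst v_eq, subst sylv_mult_vec[OF True, of x y "\<lambda>c. v $ c" "\<lambda>c. v $ (c + e)"])
            (simp add: \<alpha>_def \<beta>_def)
        then show ?thesis using v(3) True by simp
      next
        case False
        \<comment> \<open>A multiplier of degree at most \<open>e - 1\<close> times a polynomial of
          degree at most \<open>e\<close> has degree below \<open>2 * e\<close>, so the rows of the
          matrix see every coefficient.\<close>
        have small: "coeff (p * z) r = 0" if "\<And>i. e \<le> i \<Longrightarrow> coeff p i = 0" "degree z \<le> e" for p z :: "'a poly"
          unfolding coeff_mult
        proof (rule sum.neutral, rule ballI)
          fix i assume "i \<in> {..r}"
          then have "e \<le> i \<or> e < r - i" using False by auto
          then show "coeff p i * coeff z (r - i) = 0"
            using that coeff_eq_0[of z "r - i"] by auto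
        qed
        show ?thesis using small[of \<alpha> x] small[of \<beta> y] x y by (simp add: co)
      qed
    qed
  qed
qed

text \<open>Each product in the Leibniz formula has \<open>2 * e\<close> entries.\<close>

lemma degfun_det_sylv_le:
  fixes x y :: "'a::idom poly"
  assumes \<delta>: "degfun \<delta>" and x: "poly_degfun 0 \<delta> x \<le> n" and y: "poly_degfun 0 \<delta> y \<le> n"
  shows "\<delta> (det (sylv e x y)) \<le> 2 * e * n"
  unfolding det_def'[OF sylv_carrier]
proof (rule degfun_sum_le[OF \<delta>])
  fix p assume p: "p \<in> {p. p permutes {0..<2 * e}}"
  have entry: "\<delta> (sylv e x y $$ (i, p i)) \<le> n" if "i < 2 * e" for i
  proof -
    have "p i < 2 * e" using p that permutes_in_image[of p "{0..<2 * e}" i] by auto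
    then show ?thesis
      using that x y degfun_0[OF \<delta>] unfolding poly_degfun_0_le_iff[OF \<delta>]
      by (auto simp: sylv_def coeff_monom_mult)
  qed
  have "signof p = (1::'a) \<or> signof p = (-1::'a)" by (simp add: sign_def)
  then have "\<delta> (signof p) = 0" using degfun_1[OF \<delta>] degfun_uminus[OF \<delta>, of 1] by auto
  then have "\<delta> (signof p * (\<Prod>i = 0..<2 * e. sylv e x y $$ (i, p i)))
      \<le> \<delta> (\<Prod>i = 0..<2 * e. sylv e x y $$ (i, p i))"
    using degfun_mult_le[OF \<delta>, of "signof p" "\<Prod>i = 0..<2 * e. sylv e x y $$ (i, p i)"] by simp
  also have "\<dots> \<le> (\<Sum>i = 0..<2 * e. \<delta> (sylv e x y $$ (i, p i)))" by (rule degfun_prod_le[OF \<delta>])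
  also have "\<dots> \<le> (\<Sum>i = 0..<2 * e. n)" by (rule sum_mono) (use entry in auto)
  finally show "\<delta> (signof p * (\<Prod>i = 0..<2 * e. sylv e x y $$ (i, p i))) \<le> 2 * e * n" by simp
qed

text \<open>Holds even if \<open>h\<close> kills leading coefficients, because the size of the
  matrix depends on the formal degree only.\<close>

lemma hom_det_sylv:
  assumes "comm_ring_hom h"
  shows "h (det (sylv e x y)) = det (sylv e (map_poly h x) (map_poly h y))"
proof -
  interpret comm_ring_hom h by fact
  have "map_mat h (sylv e x y) = sylv e (map_poly h x) (map_poly h y)"
    by (rule eq_matI) (auto simp: sylv_def coeff_monom_mult coeff_map_poly)
  then show ?thesis using hom_det[of "sylv e x y"] by simp
qed

section \<open>Total degree and shears\<close>

abbreviation tdeg :: "'a::zero poly poly \<Rightarrow> nat" where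
  "tdeg \<equiv> poly_degfun 1 degree"

lemma degfun_tdeg: "degfun (tdeg :: 'a::idom poly poly \<Rightarrow> nat)"
  by (rule degfun_poly_degfun[OF degfun_degree])

lemma degree_le_tdeg: "degree p \<le> tdeg p"
  using poly_degfun_ge[of p "degree p" 1 degree] by (cases "p = 0") auto

text \<open>A term U^j V^e with j > 0 would exceed the total degree. Hence a divisor involving U
  alone must divide a constant.\<close>

lemma degree_coeff_tdeg:
  assumes "tdeg p \<le> e"
  shows "degree (coeff p e) = 0"
  using poly_degfun_ge[of p e 1 degree] assms by (cases "coeff p e = 0") auto

lemma tdeg_map_poly_le:
  assumes "h 0 = 0"
  shows "tdeg (map_poly (map_poly h) p) \<le> tdeg p"
  unfolding poly_degfun_le_iff
proof (intro allI impI)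
  fix i assume nz: "coeff (map_poly (map_poly h) p) i \<noteq> 0"
  then have "coeff p i \<noteq> 0" by (auto simp: coeff_map_poly assms)
  moreover have "degree (coeff (map_poly (map_poly h) p) i) \<le> degree (coeff p i)"
    by (simp add: coeff_map_poly degree_map_poly_le)
  ultimately show "1 * i + degree (coeff (map_poly (map_poly h) p) i) \<le> tdeg p"
    using poly_degfun_ge[of p i 1 degree] by simp
qed

text \<open>If \<open>c\<close> had positive V-degree, the quotients of \<open>x\<close> and
  \<open>y\<close> by \<open>c\<close> would form a syzygy of degree below \<open>e\<close>. So
  \<open>c\<close> involves U alone, and it divides a nonzero constant, namely the coefficient of
  V^e in \<open>x\<close> or \<open>y\<close>.\<close>

lemma det_sylv_nonzero_imp_unit:
  fixes x y :: "'k::field poly poly"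
  assumes det: "det (sylv e x y) \<noteq> 0" and "e > 0" and td: "tdeg x \<le> e" "tdeg y \<le> e"
    and dvd: "c dvd x" "c dvd y"
  shows "c dvd 1"
proof -
  have no_syz: "\<alpha> = 0 \<and> \<beta> = 0" if "\<alpha> * x + \<beta> * y = 0" "\<alpha> = 0 \<or> degree \<alpha> < e" "\<beta> = 0 \<or> degree \<beta> < e" for \<alpha> \<beta>
  proof (rule ccontr)
    assume nz: "\<not> (\<alpha> = 0 \<and> \<beta> = 0)"
    have "det (sylv e x y) = 0"
      by (rule det_sylv_eq_0I[of \<alpha> \<beta>]) (use that nz in \<open>auto intro: coeff_eq_0\<close>)
    then show False using det by simp
  qed
  have "x \<noteq> 0 \<or> y \<noteq> 0" using no_syz[of 1 0] \<open>e > 0\<close> by auto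
  then have "c \<noteq> 0" using dvd by auto
  obtain x' where x': "x = c * x'" using dvd(1) by (rule dvdE)
  obtain y' where y': "y = c * y'" using dvd(2) by (rule dvdE)
  have deg: "degree x \<le> e" "degree y \<le> e" using td degree_le_tdeg order_trans by blast+
  have "degree c = 0"
  proof (rule ccontr)
    assume c: "degree c \<noteq> 0"
    have "z' = 0 \<or> degree z' < e" if "degree z \<le> e" "z = c * z'" for z z'
      using that c \<open>c \<noteq> 0\<close> by (cases "z' = 0") (auto simp: degree_mult_eq)
    then have "y' = 0 \<or> degree y' < e" "- x' = 0 \<or> degree (- x') < e" using deg x' y' by auto
    moreover have "y' * x + (- x') * y = 0" unfolding x' y' by (simp add: algebra_simps)
    ultimately have "y' = 0 \<and> x' = 0" using no_syz[of y' "- x'"] by simp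
    then show False using \<open>x \<noteq> 0 \<or> y \<noteq> 0\<close> x' y' by simp
  qed
  then obtain p where p: "c = [:p:]" by (rule degree_eq_zeroE)
  \<comment> \<open>Otherwise \<open>y\<close> and \<open>- x\<close> themselves are multipliers of
    degree below \<open>e\<close> of a nontrivial syzygy.\<close>
  have "coeff x e \<noteq> 0 \<or> coeff y e \<noteq> 0"
  proof (rule ccontr)
    assume "\<not> ?thesis"
    then have "x = 0 \<or> degree x < e" "y = 0 \<or> degree y < e"
      using eq_zero_or_degree_less[of x e] eq_zero_or_degree_less[of y e] deg by auto
    moreover have "y * x + (- x) * y = 0" by simp
    ultimately have "y = 0 \<and> - x = 0" using no_syz[of y "- x"] by simp
    then show False using \<open>x \<noteq> 0 \<or> y \<noteq> 0\<close> by simp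
  qed
  then obtain z where z: "coeff z e \<noteq> 0" "tdeg z \<le> e" "c dvd z" using td dvd by blast
  have "p dvd coeff z e" using z(3) unfolding p by (simp add: const_poly_dvd_iff)
  moreover obtain k where k: "coeff z e = [:k:]" using degree_coeff_tdeg[OF z(2)] by (rule degree_eq_zeroE)
  moreover have "[:k:] dvd 1" using k z(1) by (auto simp: is_unit_const_poly_iff dvd_field_iff)
  ultimately have "p dvd 1" using dvd_trans by metis
  then show ?thesis unfolding p by (simp add: is_unit_const_poly_iff)
qed

section \<open>Homomorphisms on A[U,V] and shears\<close>

lemma map_poly_const: "h 0 = 0 \<Longrightarrow> map_poly h [:a:] = [:h a:]"
  by (rule poly_eqI) (simp add: coeff_map_poly coeff_pCons split: nat.split)

lemma comm_ring_hom_map_poly: "comm_ring_hom h \<Longrightarrow> comm_ring_hom (map_poly h)"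
proof -
  assume "comm_ring_hom h"
  then interpret h: comm_ring_hom h .
  interpret H: map_poly_comm_ring_hom h ..
  show ?thesis by (rule H.comm_ring_hom_axioms)
qed

lemma comm_ring_hom_eval_map_poly:
  assumes "comm_ring_hom h"
  shows "comm_ring_hom (\<lambda>p. poly (map_poly h p) x)"
proof -
  interpret comm_ring_hom "map_poly h" by (rule comm_ring_hom_map_poly[OF assms])
  show ?thesis by unfold_locales (auto simp: hom_distribs)
qed

lemma poly_poly_hom_eqI:
  fixes f g :: "'a::comm_ring_1 poly poly \<Rightarrow> 'b::comm_ring_1"
  assumes "comm_ring_hom f" "comm_ring_hom g"
    and const: "\<And>a. f [:[:a:]:] = g [:[:a:]:]" and U: "f [:[:0, 1:]:] = g [:[:0, 1:]:]"
    and V: "f [:0, 1:] = g [:0, 1:]"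
  shows "f p = g p"
proof -
  interpret f: comm_ring_hom f by fact
  interpret g: comm_ring_hom g by fact
  have inner: "f [:q:] = g [:q:]" for q
  proof (induction q)
    case (pCons a q)
    have "[:pCons a q:] = [:[:a:]:] + [:[:0, 1:]:] * [:q:]" by simp
    then show ?case using pCons by (simp only: f.hom_add f.hom_mult g.hom_add g.hom_mult const U)
  qed simp
  show ?thesis
  proof (induction p)
    case (pCons q p)
    have "pCons q p = [:q:] + [:0, 1:] * p" by simp
    then show ?case using pCons inner by (simp only: f.hom_add f.hom_mult g.hom_add g.hom_mult V)
  qed simp
qed

text \<open>The automorphism \<open>U \<mapsto> U + cV\<close>, \<open>V \<mapsto> V\<close> of \<open>A[U][V]\<close>.\<close>

definition shear :: "'a::comm_ring_1 \<Rightarrow> 'a poly poly \<Rightarrow> 'a poly poly" where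
  "shear c p = poly (map_poly (\<lambda>q. poly (map_poly (\<lambda>a. [:[:a:]:]) q) [:[:0, 1:], [:c:]:]) p) [:0, 1:]"

lemma comm_ring_hom_const_poly_poly: "comm_ring_hom (\<lambda>a::'a::comm_ring_1. [:[:a:]:])"
  by (rule comm_ring_hom_compose[OF comm_ring_hom_const_poly comm_ring_hom_const_poly])

lemma comm_ring_hom_shear: "comm_ring_hom (shear c)"
  unfolding shear_def
  by (intro comm_ring_hom_eval_map_poly comm_ring_hom_const_poly_poly)

lemma shear_const: "shear c [:[:a:]:] = [:[:a:]:]"
  and shear_U: "shear c [:[:0, 1:]:] = [:[:0, 1:], [:c:]:]"
  and shear_V: "shear c [:0, 1:] = [:0, 1:]"
  by (simp_all add: shear_def map_poly_const map_poly_pCons flip: one_pCons)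

lemma shear_inverse: "shear (- c) (shear c p) = p"
proof -
  interpret comm_ring_hom "shear (- c)" by (rule comm_ring_hom_shear)
  have "comm_ring_hom (\<lambda>p. shear (- c) (shear c p))"
    by (rule comm_ring_hom_compose[OF comm_ring_hom_shear comm_ring_hom_shear])
  moreover have "comm_ring_hom (\<lambda>p::'a poly poly. p)" by unfold_locales auto
  ultimately show ?thesis
  proof (rule poly_poly_hom_eqI)
    have "[:[:0, 1:], [:c:]:] = [:[:0, 1:]:] + [:[:c:]:] * [:0, 1:]" by simp
    then show "shear (- c) (shear c [:[:0, 1:]:]) = [:[:0, 1:]:]"
      by (simp only: shear_U hom_add hom_mult shear_const shear_V) simp
  qed (simp_all add: shear_const shear_V)
qed

lemma hom_shear:
  assumes h: "comm_ring_hom h"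
  shows "map_poly (map_poly h) (shear c p) = shear (h c) (map_poly (map_poly h) p)"
proof -
  interpret comm_ring_hom h by fact
  have HH: "comm_ring_hom (map_poly (map_poly h))"
    by (intro comm_ring_hom_map_poly h)
  have "comm_ring_hom (\<lambda>p. map_poly (map_poly h) (shear c p))"
    "comm_ring_hom (\<lambda>p. shear (h c) (map_poly (map_poly h) p))"
    by (rule comm_ring_hom_compose[OF comm_ring_hom_shear HH], rule comm_ring_hom_compose[OF HH comm_ring_hom_shear])
  then show ?thesis
    by (rule poly_poly_hom_eqI) (simp_all add: shear_const shear_U shear_V map_poly_const map_poly_pCons)
qed

lemma shear_dvd_1_iff: "shear c p dvd 1 \<longleftrightarrow> p dvd 1"
proof -
  interpret a: comm_ring_hom "shear c" by (rule comm_ring_hom_shear)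
  interpret b: comm_ring_hom "shear (- c)" by (rule comm_ring_hom_shear)
  show ?thesis using a.hom_dvd[of p 1] b.hom_dvd[of "shear c p" 1] by (auto simp: shear_inverse)
qed

lemma coprime_family_shear:
  assumes "coprime_family T w"
  shows "coprime_family T (\<lambda>t. shear c (w t))"
  unfolding coprime_family_def
proof (intro allI impI)
  interpret b: comm_ring_hom "shear (- c)" by (rule comm_ring_hom_shear)
  fix d assume d: "\<forall>t\<in>T. d dvd shear c (w t)"
  have "\<forall>t\<in>T. shear (- c) d dvd w t"
    using d b.hom_dvd[of d "shear c (w _)"] by (simp add: shear_inverse)
  then have "shear (- c) d dvd 1" using assms unfolding coprime_family_def by blast
  then show "d dvd 1" by (simp add: shear_dvd_1_iff)
qed

text \<open>In this expansion degrees and the coefficient of V^e can be estimated term by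
  term.\<close>

lemma shear_sum: "shear c p = (\<Sum>i\<le>degree p. \<Sum>j\<le>degree (coeff p i).
    [:[:coeff (coeff p i) j:]:] * ([:[:0, 1:], [:c:]:] ^ j * [:0, 1:] ^ i))"
proof -
  have sum: "poly (map_poly h q) x = (\<Sum>i\<le>degree q. h (coeff q i) * x ^ i)" if "h 0 = 0"
    for h :: "'b::comm_ring_1 \<Rightarrow> 'c::comm_ring_1" and q x
    using eval_poly_as_sum[of h q x] that by (simp add: eval_poly_def mult.commute)
  show ?thesis
    unfolding shear_def by (subst sum, simp, subst sum, simp) (simp add: sum_distrib_right mult.assoc)
qed

context
  fixes \<delta> :: "'a::idom \<Rightarrow> nat"
  assumes \<delta>: "degfun \<delta>"
begin

lemma degfun_poly_poly: "degfun (poly_degfun 0 (poly_degfun 0 \<delta>))"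
  by (intro degfun_poly_degfun \<delta>)

lemma poly_poly_degfun_le_iff:
  "poly_degfun 0 (poly_degfun 0 \<delta>) p \<le> n \<longleftrightarrow> (\<forall>i j. \<delta> (coeff (coeff p i) j) \<le> n)"
  by (simp add: poly_degfun_0_le_iff[OF degfun_poly_degfun[OF \<delta>]] poly_degfun_0_le_iff[OF \<delta>])

lemma poly_poly_degfun_const: "poly_degfun 0 (poly_degfun 0 \<delta>) [:[:a:]:] = \<delta> a"
  by (simp add: poly_degfun_const[OF degfun_poly_degfun[OF \<delta>]] poly_degfun_const[OF \<delta>])

lemma degfun_shear_le:
  assumes "\<delta> c = 0" "poly_degfun 0 (poly_degfun 0 \<delta>) p \<le> n"
  shows "poly_degfun 0 (poly_degfun 0 \<delta>) (shear c p) \<le> n"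
  unfolding shear_sum
proof (intro degfun_sum_le[OF degfun_poly_poly])
  let ?D = "poly_degfun 0 (poly_degfun 0 \<delta>)"
  fix i j
  have "?D [:[:0, 1:], [:c:]:] \<le> 0" "?D [:0, 1:] \<le> 0"
    unfolding poly_poly_degfun_le_iff using assms(1) degfun_1[OF \<delta>] degfun_0[OF \<delta>]
    by (auto simp: coeff_pCons split: nat.splits)
  then have "?D ([:[:0, 1:], [:c:]:] ^ j * [:0, 1:] ^ i) \<le> 0"
    using degfun_mult_le[OF degfun_poly_poly, of "[:[:0, 1:], [:c:]:] ^ j" "[:0, 1:] ^ i"]
      degfun_power_le[OF degfun_poly_poly, of "[:[:0, 1:], [:c:]:]" j]
      degfun_power_le[OF degfun_poly_poly, of "[:0, 1:]" i] by simp
  moreover have "\<delta> (coeff (coeff p i) j) \<le> n" using assms(2) unfolding poly_poly_degfun_le_iff by blast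
  ultimately show "?D ([:[:coeff (coeff p i) j:]:] * ([:[:0, 1:], [:c:]:] ^ j * [:0, 1:] ^ i)) \<le> n"
    using degfun_mult_le[OF degfun_poly_poly, of "[:[:coeff (coeff p i) j:]:]"
        "[:[:0, 1:], [:c:]:] ^ j * [:0, 1:] ^ i"]
    unfolding poly_poly_degfun_const by linarith
qed

end

lemma tdeg_shear_le:
  fixes p :: "'a::idom poly poly"
  shows "tdeg (shear c p) \<le> tdeg p"
  unfolding shear_sum[of c p]
proof (intro degfun_sum_le[OF degfun_tdeg])
  fix i j
  let ?t = "[:[:coeff (coeff p i) j:]:] * ([:[:0, 1:], [:c:]:] ^ j * [:0, 1:] ^ i)"
  show "tdeg ?t \<le> tdeg p"
  proof (cases "coeff (coeff p i) j = 0")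
    case False
    have td: "tdeg [:[:0, 1:], [:c:]:] \<le> 1" "tdeg [:0, 1 :: 'a poly:] \<le> 1" "tdeg [:[:coeff (coeff p i) j:]:] \<le> 0"
      unfolding poly_degfun_le_iff by (auto simp: coeff_pCons split: nat.splits)
    then have "tdeg ?t \<le> j + i"
      using degfun_mult_le[OF degfun_tdeg, of "[:[:coeff (coeff p i) j:]:]" "[:[:0, 1:], [:c:]:] ^ j * [:0, 1:] ^ i"]
        degfun_mult_le[OF degfun_tdeg, of "[:[:0, 1:], [:c:]:] ^ j" "[:0, 1:] ^ i"]
        degfun_power_le[OF degfun_tdeg, of "[:[:0, 1:], [:c:]:]" j]
        degfun_power_le[OF degfun_tdeg, of "[:0, 1 :: 'a poly:]" i]
        mult_le_mono2[OF td(1), of j] mult_le_mono2[OF td(2), of i]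
      unfolding mult_1_right by linarith
    moreover have "j \<le> degree (coeff p i)" using False by (rule le_degree)
    moreover have "i + degree (coeff p i) \<le> tdeg p"
      using poly_degfun_ge[of p i 1 degree] False by force
    ultimately show ?thesis by linarith
  qed (simp add: poly_degfun_def[of _ _ 0])
qed

lemma coeff_linear_poly_power:
  "coeff ([:a, b:] ^ n) n = (b::'a::comm_ring_1) ^ n \<and> (\<forall>m>n. coeff ([:a, b:] ^ n) m = 0)"
proof (induction n)
  case (Suc n)
  have *: "coeff ([:a, b:] ^ Suc n) (Suc m) = a * coeff ([:a, b:] ^ n) (Suc m) + b * coeff ([:a, b:] ^ n) m" for m
    by simp
  show ?case
  proof (intro conjI allI impI)
    show "coeff ([:a, b:] ^ Suc n) (Suc n) = b ^ Suc n" unfolding * using Suc by simp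
    fix m assume "Suc n < m"
    then obtain m' where "m = Suc m'" "n < m'" by (auto simp: Suc_less_eq2)
    then show "coeff ([:a, b:] ^ Suc n) m = 0" using * Suc by simp
  qed
qed (simp add: coeff_eq_0)

text \<open>
  The coefficient of \<open>V\<^sup>e\<close> after the shear is the value at \<open>(c, 1)\<close> of the homogeneous part of
  degree \<open>e\<close>.
\<close>

lemma coeff_shear_top:
  fixes p :: "'a::idom poly poly"
  assumes td: "tdeg p = e" and "p \<noteq> 0"
  obtains G where "G \<noteq> 0" "degree G \<le> e" "\<And>c. coeff (shear c p) e = [:poly G c:]"
proof -
  \<comment> \<open>The top homogeneous part of \<open>p\<close> with V set to 1; \<open>i\<close>
    is the exponent of V and \<open>j\<close> that of U.\<close>
  define G where "G = (\<Sum>i\<le>degree p. \<Sum>j\<le>degree (coeff p i).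
      if i + j = e then Polynomial.monom (coeff (coeff p i) j) j else 0)"
  have pij: "i + j \<le> e" if "coeff (coeff p i) j \<noteq> 0" for i j
  proof -
    have "j \<le> degree (coeff p i)" using that by (rule le_degree)
    moreover have "i + degree (coeff p i) \<le> tdeg p" using poly_degfun_ge[of p i 1 degree] that by force
    ultimately show ?thesis using td by linarith
  qed
  have coeff_G: "coeff G k = coeff (coeff p (e - k)) k" if "k \<le> e" for k
  proof -
    have "coeff G k = (\<Sum>i\<le>degree p. \<Sum>j\<le>degree (coeff p i).
        if j = k then if i = e - k then coeff (coeff p i) k else 0 else 0)"
      unfolding G_def coeff_sum using that by (intro sum.cong refl) (auto simp: coeff_monom)
    also have "\<dots> = (\<Sum>i\<le>degree p. if i = e - k then coeff (coeff p i) k else 0)"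
      by (intro sum.cong refl) (auto simp: not_le coeff_eq_0)
    also have "\<dots> = coeff (coeff p (e - k)) k" by (auto simp: not_le coeff_eq_0)
    finally show ?thesis .
  qed
  show thesis
  proof (rule that)
    obtain i where i: "coeff p i \<noteq> 0" "tdeg p = 1 * i + degree (coeff p i)"
      using poly_degfun_attained[OF \<open>p \<noteq> 0\<close>, of 1 degree] by metis
    have e: "e - degree (coeff p i) = i" "degree (coeff p i) \<le> e" using i(2) td by auto
    have "coeff G (degree (coeff p i)) = lead_coeff (coeff p i)" using coeff_G[OF e(2)] e(1) by simp
    then show "G \<noteq> 0" using i(1) by auto
    show "degree G \<le> e" unfolding G_def
      by (intro degree_sum_le) (auto intro: order_trans[OF degree_monom_le])
    fix c :: 'a
    \<comment> \<open>(U + c V)^j V^i reaches V^e without U only through its term c^j V^(i+j), and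
      only if i + j = e.\<close>
    have term_eq: "coeff ([:[:a:]:] * ([:[:0, 1:], [:c:]:] ^ j * [:0, 1:] ^ i)) e =
        (if i + j = e then [:a * c ^ j:] else 0)" if "a \<noteq> 0 \<Longrightarrow> i + j \<le> e" for a i j
    proof (cases "a = 0")
      case False
      have x: "y * [:0, 1:] ^ i = Polynomial.monom 1 i * y" for y :: "'a poly poly"
        by (simp add: monom_altdef mult.commute)
      have const: "[:c:] ^ j = [:c ^ j:]" by (induction j) (auto simp: one_pCons mult.commute)
      have "coeff ([:[:0, 1:], [:c:]:] ^ j * [:0, 1:] ^ i) e = coeff ([:[:0, 1:], [:c:]:] ^ j) (e - i)"
        using that[OF False] by (simp only: x coeff_monom_mult) simp
      also have "\<dots> = (if i + j = e then [:c ^ j:] else 0)"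
        using coeff_linear_poly_power[of "[:0, 1:]" "[:c:]" j] that[OF False] const by auto
      finally show ?thesis by simp
    qed simp
    have "coeff (shear c p) e = (\<Sum>i\<le>degree p. \<Sum>j\<le>degree (coeff p i).
        if i + j = e then [:coeff (coeff p i) j * c ^ j:] else 0)"
      unfolding shear_sum coeff_sum using pij by (intro sum.cong refl term_eq) auto
    also have "\<dots> = [:\<Sum>i\<le>degree p. \<Sum>j\<le>degree (coeff p i). if i + j = e then coeff (coeff p i) j * c ^ j else 0:]"
    proof -
      interpret comm_ring_hom "\<lambda>a::'a. [:a:]" by (rule comm_ring_hom_const_poly)
      show ?thesis unfolding hom_sum by (intro sum.cong refl) auto
    qed
    also have "\<dots> = [:poly G c:]"
      unfolding G_def poly_sum by (simp add: poly_monom if_distrib[of "\<lambda>q. poly q c"] cong: if_cong)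
    finally show "coeff (shear c p) e = [:poly G c:]" .
  qed
qed

section \<open>Specialization of coprime families\<close>

text \<open>When \<open>t\<close> is added, each \<open>p\<close> excludes at most one scalar: if
  \<open>p\<close> divides the sum for two scalars, it divides \<open>w t\<close>, hence the old
  combination, hence by induction every member. So more scalars than elements of \<open>P\<close>
  suffice.\<close>

lemma combination_avoiding_divisors:
  fixes w :: "'t \<Rightarrow> 'a::comm_ring_1" and \<iota> :: "'k \<Rightarrow> 'a" and C :: "'k set" and P :: "'a set"
  assumes "finite P" and C: "finite C" "card P < card C"
    and unit: "\<And>c c'. c \<noteq> c' \<Longrightarrow> \<iota> c - \<iota> c' dvd 1"
  shows "finite T \<Longrightarrow> \<exists>l. \<forall>p\<in>P. p dvd (\<Sum>t\<in>T. \<iota> (l t) * w t) \<longrightarrow> (\<forall>t\<in>T. p dvd w t)"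
proof (induction T rule: finite_induct)
  case (insert t T)
  then obtain l where l: "\<And>p. p \<in> P \<Longrightarrow> p dvd (\<Sum>t\<in>T. \<iota> (l t) * w t) \<Longrightarrow> \<forall>t\<in>T. p dvd w t" by blast
  define g where "g = (\<Sum>t\<in>T. \<iota> (l t) * w t)"
  define bad where "bad p c \<longleftrightarrow> p dvd g + \<iota> c * w t \<and> \<not> (\<forall>t'\<in>insert t T. p dvd w t')" for p c
  have bad_unique: "c = c'" if "p \<in> P" "bad p c" "bad p c'" for p c c'
  proof (rule ccontr)
    assume "c \<noteq> c'"
    have "p dvd (g + \<iota> c * w t) - (g + \<iota> c' * w t)" using that unfolding bad_def by (blast intro: dvd_diff)
    then have "p dvd (\<iota> c - \<iota> c') * w t" by (simp add: algebra_simps)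
    moreover obtain v where "1 = (\<iota> c - \<iota> c') * v" using unit[OF \<open>c \<noteq> c'\<close>] by (rule dvdE)
    then have "w t = v * ((\<iota> c - \<iota> c') * w t)" by (metis mult.assoc mult.commute mult_1)
    ultimately have "p dvd w t" by (metis dvd_mult)
    then have "p dvd g" using that(2) unfolding bad_def by (simp add: dvd_add_left_iff)
    then have "\<forall>t\<in>T. p dvd w t" using l[OF that(1)] unfolding g_def by blast
    then show False using \<open>p dvd w t\<close> that(2) unfolding bad_def by blast
  qed
  have "\<exists>c\<in>C. \<forall>p\<in>P. \<not> bad p c"
  proof (rule ccontr)
    assume "\<not> ?thesis"
    then obtain \<pi> where \<pi>: "\<And>c. c \<in> C \<Longrightarrow> \<pi> c \<in> P \<and> bad (\<pi> c) c" by metis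
    then have "inj_on \<pi> C" using bad_unique by (intro inj_onI) metis
    then have "card C \<le> card P" using \<pi> \<open>finite P\<close> by (intro card_inj_on_le) auto
    then show False using C by simp
  qed
  then obtain c where c: "\<And>p. p \<in> P \<Longrightarrow> \<not> bad p c" by blast
  have "(\<Sum>t'\<in>insert t T. \<iota> ((l(t := c)) t') * w t') = g + \<iota> c * w t"
    using insert.hyps unfolding g_def by (simp add: add.commute) (rule sum.cong, auto)
  then show ?case using c unfolding bad_def by (intro exI[of _ "l(t := c)"]) auto
qed auto

text \<open>\<open>P\<close> holds the irreducible factors of positive degree, at most
  \<open>degree x\<close> many. If \<open>y\<close> avoids them, they all pass, with multiplicity,
  into \<open>\<beta>\<close>. Constant factors may be shared with \<open>y\<close>, as they do not
  affect the degree.\<close>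

lemma positive_degree_irreducible_divisors:
  fixes x :: "'a::idom poly"
  assumes fac: "factorial_type TYPE('a poly)" and "x \<noteq> 0"
  shows "\<exists>P. finite P \<and> card P \<le> degree x \<and> (\<forall>p\<in>P. irreducible p) \<and>
    (\<forall>y \<beta>. (\<forall>p\<in>P. \<not> p dvd y) \<longrightarrow> x dvd \<beta> * y \<longrightarrow> \<beta> = 0 \<or> degree x \<le> degree \<beta>)"
  using factorial_onD(2)[OF fac] \<open>x \<noteq> 0\<close>
proof (induction x rule: irreducible_induct)
  case (unit u)
  then have "degree u = 0" using dvd_imp_degree_le[of u 1] by simp
  then show ?case by (intro exI[of _ "{}"]) simp
next
  case (irreducible p a)
  then obtain P where P: "finite P" "card P \<le> degree a" "\<And>q. q \<in> P \<Longrightarrow> irreducible q"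
    "\<And>y \<beta>. \<forall>q\<in>P. \<not> q dvd y \<Longrightarrow> a dvd \<beta> * y \<Longrightarrow> \<beta> = 0 \<or> degree a \<le> degree \<beta>" by metis
  have p0: "p \<noteq> 0" using irreducible.hyps(1) by (auto simp: irreducible_def)
  have deg: "degree (p * a) = degree p + degree a" using p0 irreducible.hyps(2) by (rule degree_mult_eq)
  show ?case
  proof (cases "degree p = 0")
    case True
    have "\<beta> = 0 \<or> degree (p * a) \<le> degree \<beta>" if y: "\<forall>q\<in>P. \<not> q dvd y" and dvd: "p * a dvd \<beta> * y" for y \<beta>
      using P(4)[OF y dvd_mult_right[OF dvd]] deg True by simp
    then show ?thesis using P(1,2,3) deg True by (intro exI[of _ P]) auto
  next
    case False
    have "\<beta> = 0 \<or> degree (p * a) \<le> degree \<beta>"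
      if y: "\<forall>q\<in>insert p P. \<not> q dvd y" and dvd: "p * a dvd \<beta> * y" for y \<beta>
    proof -
      have "p dvd \<beta>"
        using factorial_onD(3)[OF fac irreducible.hyps(1) dvd_mult_left[OF dvd]] y by blast
      then obtain \<gamma> where \<gamma>: "\<beta> = p * \<gamma>" by (rule dvdE)
      have "a dvd \<gamma> * y" using dvd p0 unfolding \<gamma> by (simp add: mult.assoc)
      then have "\<gamma> = 0 \<or> degree a \<le> degree \<gamma>" using P(4) y by blast
      then show ?thesis unfolding deg \<gamma> using p0 by (cases "\<gamma> = 0") (auto simp: degree_mult_eq)
    qed
    moreover have "card (insert p P) \<le> degree (p * a)"
      using P(1,2) deg False
      by (simp add: card_insert_if)
    ultimately show ?thesis using P(1,3) irreducible.hyps(1)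
      by (intro exI[of _ "insert p P"] conjI) (auto simp del: degree_mult_eq)
  qed
qed

text \<open>\<open>q\<close> is fixed before \<open>\<delta>\<close> and \<open>h\<close>, so the
  same \<open>q\<close> satisfies the bound for every degree function and serves every
  specialization that fixes the scalars.\<close>

lemma coprime_family_specialization:
  fixes w :: "'t \<Rightarrow> 'a::idom poly poly" and \<iota> :: "'k::field \<Rightarrow> 'a" and C :: "'k set"
  assumes fac: "factorial_type TYPE('a)" and \<iota>: "comm_ring_hom \<iota>"
    and T: "finite T" and cop: "coprime_family T w"
    and td: "\<And>t. t \<in> T \<Longrightarrow> tdeg (w t) \<le> D" and "D > 0" and C: "finite C" "D < card C"
  obtains q where "q \<noteq> 0"
    "\<And>\<delta> n. degfun \<delta> \<Longrightarrow> (\<And>c. \<delta> (\<iota> c) = 0) \<Longrightarrow>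
       (\<And>t. t \<in> T \<Longrightarrow> poly_degfun 0 (poly_degfun 0 \<delta>) (w t) \<le> n) \<Longrightarrow> \<delta> q \<le> 2 * D * n"
    "\<And>h. comm_ring_hom h \<Longrightarrow> (\<And>c. h (\<iota> c) = c) \<Longrightarrow> h q \<noteq> 0 \<Longrightarrow>
       coprime_family T (\<lambda>t. map_poly (map_poly h) (w t))"
proof -
  interpret \<iota>: comm_ring_hom \<iota> by (rule \<iota>)
  have \<iota>_unit: "\<iota> c dvd 1" if "c \<noteq> 0" for c
    using \<iota>.hom_dvd[of c 1] that by (simp add: dvd_field_iff)
  have \<iota>_inj: "inj \<iota>"
  proof (rule injI, rule ccontr)
    fix c c' assume "\<iota> c = \<iota> c'" "c \<noteq> c'"
    then have "\<iota> (c - c') = 0" "\<iota> (c - c') dvd 1" using \<iota>_unit[of "c - c'"] by (auto simp: \<iota>.hom_minus)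
    then show False by simp
  qed
  have nz: "\<exists>t\<in>T. w t \<noteq> 0"
  proof (rule ccontr)
    assume "\<not> ?thesis"
    then have "\<forall>t\<in>T. 0 dvd w t" by simp
    then have "0 dvd (1 :: 'a poly poly)" using cop unfolding coprime_family_def by blast
    then show False by simp
  qed
  define e where "e = Max ((\<lambda>t. tdeg (w t)) ` T)"
  have e_ge: "tdeg (w t) \<le> e" if "t \<in> T" for t unfolding e_def using that T by (intro Max_ge) auto
  have "e \<in> (\<lambda>t. tdeg (w t)) ` T" unfolding e_def using T nz by (intro Max_in) auto
  then obtain t1 where t1: "t1 \<in> T" "tdeg (w t1) = e" by blast
  have "e \<le> D" using td t1 by blast
  show thesis
  proof (cases "e = 0")
    \<comment> \<open>All cofactors are constants of A, and a nonzero one becomes a unit wherever it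
      does not vanish. The determinant of size 0 would be 1 and carry no information.\<close>
    case True
    obtain t where t: "t \<in> T" "w t \<noteq> 0" using nz by blast
    have "tdeg (w t) \<le> 0" using e_ge[OF t(1)] True by simp
    then have "degree (w t) = 0" "degree (coeff (w t) 0) = 0"
      using degree_le_tdeg[of "w t"] degree_coeff_tdeg[of "w t" 0] by auto
    then obtain a where a: "w t = [:[:a:]:]" by (metis coeff_pCons_0 degree_eq_zeroE)
    show thesis
    proof (rule that)
      show "a \<noteq> 0" using a t(2) by auto
      fix \<delta> :: "'a \<Rightarrow> nat" and n
      assume \<delta>: "degfun \<delta>" and le: "\<And>t. t \<in> T \<Longrightarrow> poly_degfun 0 (poly_degfun 0 \<delta>) (w t) \<le> n"
      have "\<delta> a \<le> n" using le[OF t(1)] unfolding a poly_poly_degfun_const[OF \<delta>] .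
      also have "\<dots> \<le> 2 * D * n" using \<open>D > 0\<close> by simp
      finally show "\<delta> a \<le> 2 * D * n" .
    next
      fix h :: "'a \<Rightarrow> 'k" assume h: "comm_ring_hom h" and ha: "h a \<noteq> 0"
      interpret comm_ring_hom h by (rule h)
      have h0: "h 0 = 0" by simp
      have "map_poly (map_poly h) (w t) dvd 1"
        unfolding a using ha by (simp add: map_poly_const h0 is_unit_const_poly_iff dvd_field_iff)
      then show "coprime_family T (\<lambda>t. map_poly (map_poly h) (w t))"
        unfolding coprime_family_def using t(1) dvd_trans by blast
    qed
  next
    case False
    then have "e > 0" by simp
    have "w t1 \<noteq> 0" using False t1(2) by (auto simp: poly_degfun_def)
    then obtain G where G: "G \<noteq> 0" "degree G \<le> e" "\<And>c. coeff (shear c (w t1)) e = [:poly G c:]"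
      using coeff_shear_top[OF t1(2)] by blast
    \<comment> \<open>\<open>G\<close> has at most \<open>e\<close> roots, \<open>e\<close> is at
      most \<open>D\<close>, and \<open>C\<close> has more than \<open>D\<close> elements.\<close>
    have "\<exists>a\<in>C. poly G (\<iota> a) \<noteq> 0"
    proof (rule ccontr)
      assume "\<not> ?thesis"
      then have "\<iota> ` C \<subseteq> {x. poly G x = 0}" by auto
      then have "card (\<iota> ` C) \<le> card {x. poly G x = 0}" using poly_roots_finite[OF G(1)] by (rule card_mono[rotated])
      also have "\<dots> \<le> degree G" using G(1) by (rule poly_roots_degree)
      finally show False using card_image[OF inj_on_subset[OF \<iota>_inj subset_UNIV], of C] G(2) \<open>e \<le> D\<close> C(2) by simp
    qed
    then obtain a where a: "poly G (\<iota> a) \<noteq> 0" by blast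
    define w' where "w' t = shear (\<iota> a) (w t)" for t
    have cop': "coprime_family T w'" unfolding w'_def by (rule coprime_family_shear[OF cop])
    have td': "tdeg (w' t) \<le> e" if "t \<in> T" for t
      using tdeg_shear_le[of "\<iota> a" "w t"] e_ge[OF that] unfolding w'_def by linarith
    have lead: "coeff (w' t1) e \<noteq> 0" using G(3) a unfolding w'_def by simp
    then have w1: "w' t1 \<noteq> 0" "degree (w' t1) = e"
      using le_degree[OF lead] degree_le_tdeg[of "w' t1"] td'[OF t1(1)] by auto
    have fac1: "factorial_type TYPE('a poly poly)" by (intro factorial_poly fac)
    obtain P where P: "finite P" "card P \<le> e" "\<And>p. p \<in> P \<Longrightarrow> irreducible p"
      "\<And>y \<beta>. \<forall>p\<in>P. \<not> p dvd y \<Longrightarrow> w' t1 dvd \<beta> * y \<Longrightarrow> \<beta> = 0 \<or> e \<le> degree \<beta>"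
      using positive_degree_irreducible_divisors[OF fac1 w1(1)] unfolding w1(2) by blast
    have unit: "[:[:\<iota> c:]:] - [:[:\<iota> c':]:] dvd 1" if "c \<noteq> c'" for c c'
      using \<iota>_unit[of "c - c'"] that by (simp add: is_unit_const_poly_iff \<iota>.hom_minus)
    have "card P < card C" using P(2) \<open>e \<le> D\<close> C(2) by linarith
    from combination_avoiding_divisors[where \<iota> = "\<lambda>c. [:[:\<iota> c:]:]" and w = w', OF P(1) C(1) this unit T]
    obtain l where l: "\<forall>p\<in>P. p dvd (\<Sum>t\<in>T. [:[:\<iota> (l t):]:] * w' t) \<longrightarrow> (\<forall>t\<in>T. p dvd w' t)" by blast
    define b where "b = (\<Sum>t\<in>T. [:[:\<iota> (l t):]:] * w' t)"
    have Pb: "\<forall>p\<in>P. \<not> p dvd b"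
    proof (intro ballI notI)
      fix p assume p: "p \<in> P" "p dvd b"
      then have "\<forall>t\<in>T. p dvd w' t" using l unfolding b_def by blast
      then have "p dvd 1" using cop' unfolding coprime_family_def by blast
      then show False using P(3)[OF p(1)] by (simp add: irreducible_def)
    qed
    have const_td: "tdeg [:[:x :: 'a:]:] = 0" for x
      using poly_degfun_const[OF degfun_degree, of 1 "[:x:]"] by simp
    have b_td: "tdeg b \<le> e" unfolding b_def
    proof (rule degfun_sum_le[OF degfun_tdeg])
      fix t assume "t \<in> T"
      then show "tdeg ([:[:\<iota> (l t):]:] * w' t) \<le> e"
        using degfun_mult_le[OF degfun_tdeg, of "[:[:\<iota> (l t):]:]" "w' t"] td' const_td by fastforce
    qed
    then have b_deg: "degree b \<le> e" using degree_le_tdeg[of b] by linarith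
    define \<Delta> where "\<Delta> = det (sylv e (w' t1) b)"
    have "\<Delta> \<noteq> 0"
    proof
      assume "\<Delta> = 0"
      then obtain \<alpha> \<beta> where ab: "\<alpha> \<noteq> 0 \<or> \<beta> \<noteq> 0" "\<And>i. e \<le> i \<Longrightarrow> coeff \<beta> i = 0" "\<alpha> * w' t1 + \<beta> * b = 0"
        using det_sylv_eq_0E[of e "w' t1" b] w1(2) b_deg unfolding \<Delta>_def by (metis order_refl)
      \<comment> \<open>Every positive-degree irreducible factor of \<open>w' t1\<close> avoids
        \<open>b\<close>, so a nonzero \<open>\<beta>\<close> would have degree at least
        \<open>e\<close>, too large for a multiplier.\<close>
      have "\<beta> * b = w' t1 * (- \<alpha>)" using ab(3) by (simp add: eq_neg_iff_add_eq_0 mult.commute add.commute)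
      then have "w' t1 dvd \<beta> * b" by (rule dvdI)
      then have "\<beta> = 0 \<or> e \<le> degree \<beta>" by (rule P(4)[OF Pb])
      then have "\<beta> = 0" using ab(2)[of "degree \<beta>"] by auto
      then show False using ab(1,3) w1(1) by simp
    qed
    show thesis
    proof (rule that)
      \<comment> \<open>\<open>\<Delta>\<close> is a polynomial in U over A; if one of its
        coefficients survives \<open>h\<close>, the specialized determinant is nonzero.\<close>
      show "lead_coeff \<Delta> \<noteq> 0" using \<open>\<Delta> \<noteq> 0\<close> by simp
    next
      fix \<delta> :: "'a \<Rightarrow> nat" and n
      assume \<delta>: "degfun \<delta>" and \<delta>\<iota>: "\<And>c. \<delta> (\<iota> c) = 0"
        and le: "\<And>t. t \<in> T \<Longrightarrow> poly_degfun 0 (poly_degfun 0 \<delta>) (w t) \<le> n"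
      note \<delta>1 = degfun_poly_degfun[OF \<delta>, of 0] and \<delta>2 = degfun_poly_poly[OF \<delta>]
      have le': "poly_degfun 0 (poly_degfun 0 \<delta>) (w' t) \<le> n" if "t \<in> T" for t
        unfolding w'_def by (rule degfun_shear_le[OF \<delta> \<delta>\<iota> le[OF that]])
      have "poly_degfun 0 (poly_degfun 0 \<delta>) b \<le> n" unfolding b_def
      proof (rule degfun_sum_le[OF \<delta>2])
        fix t assume "t \<in> T"
        then show "poly_degfun 0 (poly_degfun 0 \<delta>) ([:[:\<iota> (l t):]:] * w' t) \<le> n"
          using degfun_mult_le[OF \<delta>2, of "[:[:\<iota> (l t):]:]" "w' t"] le'
          unfolding poly_poly_degfun_const[OF \<delta>] \<delta>\<iota> by fastforce
      qed
      then have "poly_degfun 0 \<delta> \<Delta> \<le> 2 * e * n"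
        unfolding \<Delta>_def by (intro degfun_det_sylv_le[OF \<delta>1] le' t1(1))
      then have "\<delta> (lead_coeff \<Delta>) \<le> 2 * e * n" using degfun_coeff_le[OF \<delta>, of \<Delta> "degree \<Delta>" 0] by linarith
      also have "\<dots> \<le> 2 * D * n" using \<open>e \<le> D\<close> by simp
      finally show "\<delta> (lead_coeff \<Delta>) \<le> 2 * D * n" .
    next
      fix h :: "'a \<Rightarrow> 'k"
      assume h: "comm_ring_hom h" and h\<iota>: "\<And>c. h (\<iota> c) = c" and hq: "h (lead_coeff \<Delta>) \<noteq> 0"
      interpret h: comm_ring_hom h by (rule h)
      interpret HH: comm_ring_hom "map_poly (map_poly h)" by (intro comm_ring_hom_map_poly h)
      interpret S: comm_ring_hom "shear a" by (rule comm_ring_hom_shear)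
      let ?HH = "map_poly (map_poly h)"
      have "coeff (map_poly h \<Delta>) (degree \<Delta>) = h (lead_coeff \<Delta>)" by (rule coeff_map_poly) simp
      then have "map_poly h \<Delta> \<noteq> 0" using hq by (metis coeff_0)
      then have det: "det (sylv e (?HH (w' t1)) (?HH b)) \<noteq> 0"
        unfolding \<Delta>_def using hom_det_sylv[OF comm_ring_hom_map_poly[OF h]] by metis
      show "coprime_family T (\<lambda>t. ?HH (w t))"
        unfolding coprime_family_def
      proof (intro allI impI)
        fix c assume c: "\<forall>t\<in>T. c dvd ?HH (w t)"
        \<comment> \<open>Since \<open>h\<close> fixes scalars, specialization turns the shear by
          \<open>\<iota> a\<close> into the shear by \<open>a\<close>.\<close>
        have dvd: "shear a c dvd ?HH (w' t)" if "t \<in> T" for t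
          unfolding w'_def hom_shear[OF h] h\<iota> using c that by (intro S.hom_dvd) blast
        have "shear a c dvd ?HH b" unfolding b_def HH.hom_sum HH.hom_mult
          using dvd by (intro dvd_sum dvd_mult)
        moreover have "tdeg (?HH (w' t1)) \<le> e" "tdeg (?HH b) \<le> e"
          using tdeg_map_poly_le[of h] td'[OF t1(1)] b_td h.hom_zero order_trans by blast+
        ultimately have "shear a c dvd 1"
          using det_sylv_nonzero_imp_unit[OF det \<open>e > 0\<close>] dvd[OF t1(1)] by blast
        then show "c dvd 1" by (simp add: shear_dvd_1_iff)
      qed
    qed
  qed
qed

text \<open>On coefficients that are scalars, \<open>\<iota>\<close> inverts \<open>h\<close>, so a
  common divisor after specialization lifts to one of the original family.\<close>

lemma coprime_family_constant_specialization:
  fixes w :: "'t \<Rightarrow> 'a::comm_ring_1 poly poly"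
  assumes h: "comm_ring_hom h" and \<iota>: "comm_ring_hom \<iota>" and h\<iota>: "\<And>c. h (\<iota> c) = c"
    and cop: "coprime_family T w" and const: "\<And>t i j. t \<in> T \<Longrightarrow> \<iota> (h (coeff (coeff (w t) i) j)) = coeff (coeff (w t) i) j"
  shows "coprime_family T (\<lambda>t. map_poly (map_poly h) (w t))"
  unfolding coprime_family_def
proof (intro allI impI)
  let ?H = "map_poly (map_poly h)" and ?I = "map_poly (map_poly \<iota>)"
  interpret h: comm_ring_hom h by (rule h)
  interpret \<iota>: comm_ring_hom \<iota> by (rule \<iota>)
  interpret H: comm_ring_hom ?H by (intro comm_ring_hom_map_poly h)
  interpret I: comm_ring_hom ?I by (intro comm_ring_hom_map_poly \<iota>)
  fix c assume c: "\<forall>t\<in>T. c dvd ?H (w t)"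
  have "?I (?H (w t)) = w t" if "t \<in> T" for t
    by (intro poly_eqI) (simp add: coeff_map_poly const[OF that])
  then have "\<forall>t\<in>T. ?I c dvd w t" using c I.hom_dvd by metis
  then have "?I c dvd 1" using cop unfolding coprime_family_def by blast
  then have "?H (?I c) dvd ?H 1" by (rule H.hom_dvd)
  moreover have "?H (?I c) = c" by (intro poly_eqI) (simp add: coeff_map_poly h\<iota>)
  ultimately show "c dvd 1" by simp
qed

section \<open>Specialization of the spectral polynomial\<close>

lemma pencil_coeff_eq:
  "pencil_coeff f g e = [:[:0, - Poly_Mapping.lookup g e:], [:Poly_Mapping.lookup f e:]:]"
  by (simp add: pencil_coeff_def var_U_def var_V_def)

lemma ev_int_eq_mpoly_eval: "ev_int = mpoly_eval of_int"
  by (simp add: fun_eq_iff ev_int_def mpoly_eval_def)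

lemma tdeg_ev_int_pencil_le:
  fixes f g :: "(nat, 'a::idom) mpoly"
  shows "tdeg (ev_int (pencil_coeff f g) P) \<le> mdeg P"
proof -
  have "tdeg (pencil_coeff f g e) \<le> 1" for e
    unfolding pencil_coeff_eq poly_degfun_le_iff by (auto simp: coeff_pCons split: nat.splits)
  then show ?thesis
    using degfun_mpoly_eval_le[OF degfun_tdeg degfun_of_int[OF degfun_tdeg], of P "pencil_coeff f g" 1]
    by (simp add: ev_int_eq_mpoly_eval)
qed

lemma degfun_ev_int_pencil_le:
  fixes f g :: "(nat, 'a::idom) mpoly"
  assumes \<delta>: "degfun \<delta>" and "\<And>e. \<delta> (Poly_Mapping.lookup f e) \<le> n" "\<And>e. \<delta> (Poly_Mapping.lookup g e) \<le> n"
  shows "poly_degfun 0 (poly_degfun 0 \<delta>) (ev_int (pencil_coeff f g) P) \<le> mdeg P * n"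
proof -
  note \<delta>2 = degfun_poly_poly[OF \<delta>]
  have "poly_degfun 0 (poly_degfun 0 \<delta>) (pencil_coeff f g e) \<le> n" for e
    unfolding pencil_coeff_eq poly_poly_degfun_le_iff[OF \<delta>]
    using assms degfun_0[OF \<delta>] degfun_uminus[OF \<delta>] by (auto simp: coeff_pCons split: nat.splits)
  then show ?thesis
    unfolding ev_int_eq_mpoly_eval by (intro degfun_mpoly_eval_le[OF \<delta>2 degfun_of_int[OF \<delta>2]])
qed

lemma comm_ring_hom_ev: "comm_ring_hom (ev (z :: 'v \<Rightarrow> 'a::comm_ring_1))"
proof -
  have "ev z = mpoly_eval (\<lambda>c. c) z" by (simp add: fun_eq_iff ev_def mpoly_eval_def)
  moreover have "comm_ring_hom (\<lambda>c::'a. c)" by unfold_locales auto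
  ultimately show ?thesis using comm_ring_hom_mpoly_eval by metis
qed

lemma ev_mconst: "ev z (mconst c) = c"
  by (simp add: ev_def mon_eval_0)

lemma ev_mvar: "ev z (mvar v) = z v"
  unfolding ev_def mvar_def by (simp add: mon_eval_single[unfolded One_nat_def])

text \<open>The forms have integer coefficients, which every ring homomorphism respects, and the
  pencil depends on \<open>f\<close> and \<open>g\<close> coefficientwise.\<close>

lemma hom_ev_int_pencil:
  fixes f g :: "(nat, 'a::comm_ring_1) mpoly"
  assumes h: "comm_ring_hom h"
  shows "map_poly (map_poly h) (ev_int (pencil_coeff f g) P) =
    ev_int (pencil_coeff (Poly_Mapping.map h f) (Poly_Mapping.map h g)) P"
proof -
  interpret h: comm_ring_hom h by (rule h)
  have HH: "comm_ring_hom (map_poly (map_poly h))" by (intro comm_ring_hom_map_poly h)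
  interpret HH: comm_ring_hom "map_poly (map_poly h)" by (rule HH)
  have "Poly_Mapping.lookup (Poly_Mapping.map h f) e = h (Poly_Mapping.lookup f e)"
    for f :: "(nat, 'a) mpoly" and e
    by (simp add: Poly_Mapping.map.rep_eq when_def)
  then have "map_poly (map_poly h) (pencil_coeff f g e) =
      pencil_coeff (Poly_Mapping.map h f) (Poly_Mapping.map h g) e" for e
    unfolding pencil_coeff_eq
    by (intro poly_eqI) (simp add: coeff_map_poly coeff_pCons h.hom_uminus split: nat.split)
  then show ?thesis
    unfolding ev_int_eq_mpoly_eval using hom_mpoly_eval[OF HH, of of_int "pencil_coeff f g" P]
    by (simp add: HH.hom_of_int)
qed

lemma vanishing_mpoly:
  assumes fin: "finite (UNIV :: 'k::field set)" and "0 < s"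
  shows "\<exists>q :: (nat, 'k) mpoly. q \<noteq> 0 \<and> in_vars {..<s} q \<and> mdeg q \<le> card (UNIV :: 'k set) \<and> (\<forall>z. ev z q = 0)"
proof (intro exI conjI allI)
  let ?x = "\<lambda>a::'k. mvar (0::nat) - mconst a" and ?q = "\<Prod>a\<in>UNIV. mvar (0::nat) - mconst (a::'k)"
  \<comment> \<open>Used twice: \<open>n = 0\<close> with the weights \<open>later_vars s\<close>
    shows which indeterminates occur, \<open>n = 1\<close> bounds the total degree.\<close>
  have bound: "\<delta> ?q \<le> card (UNIV :: 'k set) * n"
    if \<delta>: "degfun \<delta>" and "\<delta> (mvar 0) \<le> n" "\<And>c. \<delta> (mconst c) = 0" for \<delta> :: "(nat, 'k) mpoly \<Rightarrow> nat" and n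
  proof -
    have "\<delta> (?x a) \<le> n" for a
      using degfun_diff_le_max[OF \<delta>, of "mvar 0" "mconst a"] that by simp
    then have "(\<Sum>a\<in>UNIV. \<delta> (?x a)) \<le> (\<Sum>a\<in>(UNIV :: 'k set). n)" by (intro sum_mono)
    then show ?thesis using degfun_prod_le[OF \<delta>, of ?x UNIV] by simp
  qed
  have "Poly_Mapping.single 0 1 \<noteq> (0 :: nat monom)" by (metis lookup_single_eq lookup_zero zero_neq_one)
  then have "Poly_Mapping.lookup (?x a) (Poly_Mapping.single 0 1) = 1" for a
    by (simp add: lookup_minus mvar_def lookup_single when_def)
  then have "?x a \<noteq> 0" for a by (metis lookup_zero zero_neq_one)
  then show "?q \<noteq> 0" using fin by simp
  have "wdeg (later_vars s) ?q \<le> card (UNIV :: 'k set) * 0"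
  proof (rule bound[OF degfun_wdeg])
    have "in_vars {..<s} (mvar 0 :: (nat, 'k) mpoly)" using \<open>0 < s\<close> by (auto simp: in_vars_def mvar_def)
    then show "wdeg (later_vars s) (mvar 0 :: (nat, 'k) mpoly) \<le> 0" by (simp add: wdeg_later_vars_eq_0_iff)
  qed (simp add: wdeg_mconst)
  then show "in_vars {..<s} ?q" by (simp add: wdeg_later_vars_eq_0_iff)
  have "mdeg ?q \<le> card (UNIV :: 'k set) * 1"
  proof (rule bound[OF degfun_mdeg])
    show "mdeg (mvar 0 :: (nat, 'k) mpoly) \<le> 1" unfolding mdeg_eq_wdeg wdeg_le_iff by (simp add: mvar_def mon_wdeg_def)
  qed (simp add: mdeg_eq_wdeg wdeg_mconst)
  then show "mdeg ?q \<le> card (UNIV :: 'k set)" by simp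
  fix z :: "nat \<Rightarrow> 'k"
  interpret comm_ring_hom "ev z" by (rule comm_ring_hom_ev)
  have "ev z ?q = (\<Prod>a\<in>UNIV. z 0 - a)" by (simp add: hom_prod hom_minus ev_mconst ev_mvar)
  also have "\<dots> = 0" using fin by (auto simp: prod_zero_iff)
  finally show "ev z ?q = 0" .
qed

theorem theorem2p3:
  fixes f g :: "(nat, (nat, 'k::field) mpoly) mpoly"
    and s n d k :: nat
    and T :: "'t set" and \<Phi> :: "'t \<Rightarrow> (nat monom, int) mpoly"
  assumes "2 \<le> n" and "2 \<le> d"
    and "noether_forms TYPE('u) n d T \<Phi>"
    and "in_vars {..<n} f" and "in_vars {..<n} g"
    and "\<And>e. in_vars {..<s} (Poly_Mapping.lookup f e)"
    and "\<And>e. in_vars {..<s} (Poly_Mapping.lookup g e)"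
    and "coprime_elems f g"
    and "\<And>e. mdeg (Poly_Mapping.lookup f e) \<le> k" and "\<And>e. mdeg (Poly_Mapping.lookup g e) \<le> k"
    and "mdeg f \<le> d" and "mdeg g \<le> d" and "max (mdeg f) (mdeg g) = d"
  shows "\<exists>Q :: (nat, 'k) mpoly set.
           finite Q \<and> Q \<noteq> {} \<and>
           (\<forall>q\<in>Q. in_vars {..<s} q \<and> q \<noteq> 0 \<and> mdeg q \<le> 2 * (d\<^sup>2 - 1)\<^sup>2 * k) \<and>
           (\<forall>z :: nat \<Rightarrow> 'k. (\<exists>q\<in>Q. ev z q \<noteq> 0) \<longrightarrow>
              (\<exists>\<kappa>. \<kappa> \<noteq> 0 \<and>
                 map_poly (map_poly (ev z)) (spect_mpoly T \<Phi> f g) =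
                 Polynomial.smult [:\<kappa>:]
                   (spect_field T \<Phi> (Poly_Mapping.map (ev z) f) (Poly_Mapping.map (ev z) g))))"
proof -
  define D where "D = d\<^sup>2 - 1"
  define S where "S = spect_mpoly T \<Phi> f g"
  define b where "b t = ev_int (pencil_coeff f g) (\<Phi> t)" for t
  define good where "good z \<longleftrightarrow> (\<exists>\<kappa>. \<kappa> \<noteq> 0 \<and> map_poly (map_poly (ev z)) S = Polynomial.smult [:\<kappa>:]
     (spect_field T \<Phi> (Poly_Mapping.map (ev z) f) (Poly_Mapping.map (ev z) g)))" for z :: "nat \<Rightarrow> 'k"
  have T: "finite T" and \<Phi>: "\<And>t. t \<in> T \<Longrightarrow> mdeg (\<Phi> t) \<le> D"
    using assms(3) unfolding noether_forms_def D_def by auto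
  have "2 ^ 2 \<le> d\<^sup>2" using \<open>2 \<le> d\<close> by (rule power_mono) simp
  then have "D > 0" unfolding D_def by simp
  \<comment> \<open>A single \<open>q\<close> is enough. In its bound, \<open>2 * D\<close> is the
    size of the determinant and \<open>D * k\<close> the degree of its entries.\<close>
  have suffices: ?thesis
    if "q \<noteq> 0" "in_vars {..<s} q" "mdeg q \<le> 2 * D * (D * k)" "\<And>z. ev z q \<noteq> 0 \<Longrightarrow> good z" for q
  proof -
    have eq: "2 * D * (D * k) = 2 * (d\<^sup>2 - 1)\<^sup>2 * k" by (simp add: D_def power2_eq_square)
    have "mdeg q \<le> 2 * (d\<^sup>2 - 1)\<^sup>2 * k" using that(3) unfolding eq .
    then show ?thesis using that(1,2,4) unfolding good_def S_def by (intro exI[of _ "{q}"]) simp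
  qed
  have one: "in_vars {..<s} (1 :: (nat, 'k) mpoly)" "mdeg (1 :: (nat, 'k) mpoly) = 0"
    by (auto simp: in_vars_def mdeg_def mon_deg_def)
  have gcd: "is_gcd (b ` T) S" unfolding b_def S_def by (rule spect_mpoly_is_gcd)
  have ev_b: "map_poly (map_poly (ev z)) (b t) =
      ev_int (pencil_coeff (Poly_Mapping.map (ev z) f) (Poly_Mapping.map (ev z) g)) (\<Phi> t)" for z t
    unfolding b_def by (rule hom_ev_int_pencil[OF comm_ring_hom_ev])
  have goodI: "good z" if "is_gcd ((\<lambda>t. map_poly (map_poly (ev z)) (b t)) ` T) (map_poly (map_poly (ev z)) S)" for z
    using that unfolding good_def ev_b by (rule is_gcd_spect_field)
  show ?thesis
  proof (cases "S = 0")
    \<comment> \<open>All \<open>b t\<close> vanish, and so do their specializations; both GCDs are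
      0, at every point.\<close>
    case True
    have "b t = 0" if "t \<in> T" for t using gcd that True unfolding is_gcd_def by auto
    then have "is_gcd ((\<lambda>t. map_poly (map_poly (ev z)) (b t)) ` T) (map_poly (map_poly (ev z)) S)" for z
      using True by (auto simp: is_gcd_def)
    then show ?thesis using goodI one by (intro suffices[of 1]) auto
  next
    case False
    have "\<forall>t\<in>T. S dvd b t" using gcd unfolding is_gcd_def by blast
    then have "\<forall>t\<in>T. \<exists>w. b t = S * w" unfolding dvd_def .
    then obtain w where w: "\<And>t. t \<in> T \<Longrightarrow> b t = S * w t" by metis
    \<comment> \<open>A common divisor of the cofactors times \<open>S\<close> would still divide
      every \<open>b t\<close>, hence divide the GCD \<open>S\<close>.\<close>
    have cop: "coprime_family T w"
      unfolding coprime_family_def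
    proof (intro allI impI)
      fix c assume "\<forall>t\<in>T. c dvd w t"
      then have "\<forall>p\<in>b ` T. S * c dvd p" using w by (auto intro: mult_dvd_mono)
      then have "S * c dvd S * 1" using gcd unfolding is_gcd_def by simp
      then show "c dvd 1" using False by (simp only: dvd_mult_cancel_left) simp
    qed
    have goodI': "good z" if "coprime_family T (\<lambda>t. map_poly (map_poly (ev z)) (w t))" for z
    proof (rule goodI, rule is_gcd_of_decomposition[OF _ that])
      interpret HH: comm_ring_hom "map_poly (map_poly (ev z))" by (intro comm_ring_hom_map_poly comm_ring_hom_ev)
      show "map_poly (map_poly (ev z)) (b t) = map_poly (map_poly (ev z)) S * map_poly (map_poly (ev z)) (w t)"
        if "t \<in> T" for t using w[OF that] by (simp add: HH.hom_mult)
    qed (intro factorial_poly factorial_field)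
    \<comment> \<open>\<open>w t\<close> divides \<open>b t\<close>, so any additive degree bounded
      on \<open>b t\<close> is bounded on \<open>w t\<close> by the same number.\<close>
    have degfun_w: "\<delta> (w t) \<le> m" if "degfun \<delta>" "\<delta> (b t) \<le> m" "t \<in> T" for \<delta> m t
    proof (cases "w t = 0")
      case True
      then show ?thesis using degfun_0[OF that(1)] by simp
    next
      case w0: False
      have "w t dvd b t" "b t \<noteq> 0" using w[OF that(3)] w0 False by auto
      then show ?thesis using degfun_dvd_le[OF that(1)] that(2) order_trans by blast
    qed
    have td: "tdeg (w t) \<le> D" if "t \<in> T" for t
      by (rule degfun_w[OF degfun_tdeg _ that])
        (use tdeg_ev_int_pencil_le[of f g "\<Phi> t"] \<Phi>[OF that] b_def in \<open>metis order_trans\<close>)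
    have zd: "poly_degfun 0 (poly_degfun 0 \<delta>) (w t) \<le> D * m"
      if \<delta>: "degfun \<delta>" and "\<And>e. \<delta> (Poly_Mapping.lookup f e) \<le> m" "\<And>e. \<delta> (Poly_Mapping.lookup g e) \<le> m" and t: "t \<in> T"
      for \<delta> m t
    proof (rule degfun_w[OF degfun_poly_poly[OF \<delta>] _ t])
      show "poly_degfun 0 (poly_degfun 0 \<delta>) (b t) \<le> D * m"
        using degfun_ev_int_pencil_le[OF that(1-3), of "\<Phi> t"] mult_le_mono1[OF \<Phi>[OF t], of m]
        unfolding b_def by linarith
    qed
    \<comment> \<open>The constant case is split off first: the vanishing polynomial of the small
      case needs an indeterminate, hence \<open>s > 0\<close>, and its degree, at most
      \<open>D\<close>, fits under \<open>2 * D * (D * k)\<close> only if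
      \<open>k > 0\<close>.\<close>
    consider (const) "k = 0 \<or> s = 0" | (small) "s > 0" "k > 0" "finite (UNIV :: 'k set)" "card (UNIV :: 'k set) \<le> D"
      | (large) "\<exists>C :: 'k set. finite C \<and> D < card C"
      by (metis infinite_arbitrarily_large less_Suc_eq_le not_gr_zero not_le order_refl)
    then show ?thesis
    proof cases
      case const
      have mdeg0: "mdeg (Poly_Mapping.lookup f e) \<le> 0" "mdeg (Poly_Mapping.lookup g e) \<le> 0" for e
      proof -
        have "later_vars 0 = (\<lambda>_. 1)" by (simp add: later_vars_def fun_eq_iff)
        then have "mdeg p = 0" if "in_vars {..<0} p" for p :: "(nat, 'k) mpoly"
          using that wdeg_later_vars_eq_0_iff[of 0 p] by (simp add: mdeg_eq_wdeg)
        then show "mdeg (Poly_Mapping.lookup f e) \<le> 0" "mdeg (Poly_Mapping.lookup g e) \<le> 0"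
          using const assms(6,7,9,10)[of e] by (metis le_zero_eq)+
      qed
      have "good z" for z
      proof (rule goodI', rule coprime_family_constant_specialization[OF comm_ring_hom_ev comm_ring_hom_mconst ev_mconst cop])
        fix t i j assume "t \<in> T"
        \<comment> \<open>Coefficients of \<open>f\<close> and \<open>g\<close> of degree 0 make
          those of the cofactors scalars as well.\<close>
        then have "mdeg (coeff (coeff (w t) i) j) \<le> D * 0"
          using zd[OF degfun_mdeg mdeg0] unfolding poly_poly_degfun_le_iff[OF degfun_mdeg] by blast
        then have "coeff (coeff (w t) i) j = mconst (Poly_Mapping.lookup (coeff (coeff (w t) i) j) 0)"
          by (intro mdeg_0_imp_mconst) simp
        then show "mconst (ev z (coeff (coeff (w t) i) j)) = coeff (coeff (w t) i) j" by (metis ev_mconst)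
      qed
      then show ?thesis using one by (intro suffices[of 1]) auto
    next
      case small
      obtain q :: "(nat, 'k) mpoly" where q: "q \<noteq> 0" "in_vars {..<s} q" "mdeg q \<le> card (UNIV :: 'k set)" "\<forall>z. ev z q = 0"
        using vanishing_mpoly[OF small(3,1)] by blast
      have "D * 1 \<le> D * (2 * (D * k))" using \<open>D > 0\<close> \<open>k > 0\<close> by (intro mult_le_mono2) simp
      also have "D * (2 * (D * k)) = 2 * D * (D * k)" by simp
      finally have "mdeg q \<le> 2 * D * (D * k)" using q(3) small(4) by linarith
      then show ?thesis using q by (intro suffices[of q]) auto
    next
      case large
      then obtain C :: "'k set" where C: "finite C" "D < card C" by blast
      obtain q where q: "q \<noteq> 0"
        "\<And>\<delta> n. degfun \<delta> \<Longrightarrow> (\<And>c. \<delta> (mconst c) = 0) \<Longrightarrow>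
           (\<And>t. t \<in> T \<Longrightarrow> poly_degfun 0 (poly_degfun 0 \<delta>) (w t) \<le> n) \<Longrightarrow> \<delta> q \<le> 2 * D * n"
        "\<And>h. comm_ring_hom h \<Longrightarrow> (\<And>c. h (mconst c) = c) \<Longrightarrow> h q \<noteq> 0 \<Longrightarrow>
           coprime_family T (\<lambda>t. map_poly (map_poly h) (w t))"
        using coprime_family_specialization[OF factorial_mpoly comm_ring_hom_mconst T cop td \<open>D > 0\<close> C] by blast
      \<comment> \<open>The same degree bound, applied to the weights \<open>later_vars s\<close>,
        shows that \<open>q\<close> involves only the first \<open>s\<close> indeterminates.\<close>
      have "wdeg (later_vars s) q \<le> 2 * D * (D * 0)"
        by (intro q(2) degfun_wdeg wdeg_mconst zd) (simp_all add: wdeg_later_vars_eq_0_iff assms(6,7))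
      moreover have "mdeg q \<le> 2 * D * (D * k)"
        by (intro q(2) degfun_mdeg zd assms(9,10)) (simp add: mdeg_eq_wdeg wdeg_mconst)
      moreover have "good z" if "ev z q \<noteq> 0" for z
        by (intro goodI' q(3) comm_ring_hom_ev ev_mconst that)
      ultimately show ?thesis using q(1) by (intro suffices[of q]) (auto simp: wdeg_later_vars_eq_0_iff)
    qed
  qed
qed

end
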